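(* Let $\mathcal{C}$ be an algebraically closed field of arbitrary characteristic, $(\mathcal{E},o)$ an elliptic curve over $\mathcal{C}$ with function field $\mathcal{K}$, $s\in\mathcal{E}(\mathcal{C})$ a non-torsion point, and $\tau$ the automorphism of $\mathcal{K}$ induced by addition by $s$. Let $\mathcal{R}=\{\alpha_\omega\}_{\omega\in\mathcal{E}/\tau}$ be a set of $\tau$-orbit representatives in $\mathcal{E}(\mathcal{C})$, and let $a\in\mathcal{K}^\times$. There exist $r\in\mathcal{K}^\times$ and $c\in\mathcal{C}^\times$ such that $a=c\cdot\tau(r)/r$ if and only if the following conditions hold: (1) $\displaystyle\sum_{\alpha\in\omega}\nu_\alpha(a)=0$ for each $\omega\in\mathcal{E}/\tau$; (2) $\displaystyle\sum_{\omega\in\mathcal{E}/\tau}\sum_{n\in\mathbb{Z}}n\cdot\nu_{\alpha_\omega\oplus ns}(a)=0$; and (3) $\displaystyle\sum_{\omega\in\mathcal{E}/\tau}\sum_{n\in\mathbb{Z}}n\cdot\nu_{\alpha_\omega\oplus ns}(a)\cdot\alpha_\omega\ \oplus\ \sum_{\omega\in\mathcal{E}/\tau}\sum_{n\in\mathbb{Z}}\frac{n(n+1)}{2}\cdot\nu_{\alpha_\omega\oplus ns}(a)\cdot s=o$, where the sums and integer multiples are taken in the group $\mathcal{E}(\mathcal{C})$.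
   Context: $\oplus$ is the group law of $\mathcal{E}$ with identity $o$; $\nu_\alpha$ is the valuation of $\mathcal{K}=\mathcal{C}(\mathcal{E})$ at $\alpha\in\mathcal{E}(\mathcal{C})$; $\tau$ is the $\mathcal{C}$-linear automorphism of $\mathcal{K}$ induced by $\alpha\mapsto\alpha\oplus s$, so $\nu_\alpha(\tau(f))=\nu_{\alpha\oplus s}(f)$. $\mathcal{E}/\tau$ is the set of cosets (orbits) of $\mathbb{Z}s$ in $\mathcal{E}(\mathcal{C})$; a set of $\tau$-orbit representatives is a choice of one $\alpha_\omega\in\omega$ for each $\omega\in\mathcal{E}/\tau$. *)

theory Defs
  imports
    "HOL-Computational_Algebra.Polynomial"
    "HOL-Algebra.Free_Abelian_Groups"
begin

section \<open>Elliptic curves in Weierstrass form and their points\<close>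

text \<open>
  The record stands for the plane cubic
  \<open>y^2 + A1 x y + A3 y = x^3 + A2 x^2 + A4 x + A6\<close>, which covers every characteristic.
\<close>

record 'c weierstrass =
  A1 :: 'c
  A2 :: 'c
  A3 :: 'c
  A4 :: 'c
  A6 :: 'c

text \<open>Bivariate polynomials over \<open>'c\<close> are \<open>'c poly poly\<close>: the outer variable is \<open>y\<close>.\<close>

definition eval2 :: "'c::comm_ring_1 poly poly \<Rightarrow> 'c \<Rightarrow> 'c \<Rightarrow> 'c"
  where "eval2 P u v = poly (poly P [:v:]) u"

definition weierstrass_poly :: "'c::field weierstrass \<Rightarrow> 'c poly poly"
  where "weierstrass_poly E =
    [: - [:A6 E, A4 E, A2 E, 1:], [:A3 E, A1 E:], 1 :]"

datatype 'c point = Infinity | Affine 'c 'c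

text \<open>\<open>Infinity\<close> is the projective point \<open>[0:1:0]\<close>, the origin \<open>o\<close> of the group law.\<close>

definition curve_points :: "'c::field weierstrass \<Rightarrow> 'c point set"
  where "curve_points E =
    insert Infinity {Affine u v |u v. eval2 (weierstrass_poly E) u v = 0}"

text \<open>
  An elliptic curve is a nonsingular Weierstrass cubic: the two partial derivatives of
  the Weierstrass polynomial have no common zero on the affine curve (the point at infinity
  is always nonsingular). This is the right notion over an algebraically closed field,
  where all geometric points are visible.
\<close>

definition elliptic_curve :: "'c::alg_closed_field weierstrass \<Rightarrow> bool"
  where "elliptic_curve E \<longleftrightarrow>
    (\<forall>u v. eval2 (weierstrass_poly E) u v = 0 \<longrightarrow>
       eval2 (map_poly pderiv (weierstrass_poly E)) u v \<noteq> 0 \<or>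
       eval2 (pderiv (weierstrass_poly E)) u v \<noteq> 0)"


section \<open>The chord-tangent group law\<close>

text \<open>
  In \<open>curve_add\<close>, \<open>l\<close> is the slope of the chord, or of the tangent if the two points
  coincide, and \<open>(x3, - l (x3 - x1) - y1 - A1 x3 - A3)\<close> is the negative of the third point of
  intersection with the curve.
\<close>

fun curve_add :: "'c::field weierstrass \<Rightarrow> 'c point \<Rightarrow> 'c point \<Rightarrow> 'c point"
  where
    "curve_add E Infinity Q = Q"
  | "curve_add E (Affine x1 y1) Infinity = Affine x1 y1"
  | "curve_add E (Affine x1 y1) (Affine x2 y2) =
      (if x1 = x2 \<and> y1 + y2 + A1 E * x2 + A3 E = 0 then Infinity
       else
         let l = (if x1 = x2
                  then (3 * x1 ^ 2 + 2 * A2 E * x1 + A4 E - A1 E * y1)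
                         / (2 * y1 + A1 E * x1 + A3 E)
                  else (y2 - y1) / (x2 - x1));
             x3 = l ^ 2 + A1 E * l - A2 E - x1 - x2
         in Affine x3 (- l * (x3 - x1) - y1 - A1 E * x3 - A3 E))"

text \<open>
  The group is written multiplicatively, following \<open>HOL-Algebra\<close>: \<open>P \<otimes> Q\<close> is the sum of
  \<open>P\<close> and \<open>Q\<close>, and \<open>P [^] k\<close> is the integer multiple \<open>k P\<close>.
\<close>

definition curve_group :: "'c::field weierstrass \<Rightarrow> 'c point monoid"
  where "curve_group E =
    \<lparr>carrier = curve_points E, mult = curve_add E, one = Infinity\<rparr>"


section \<open>The function field\<close>

text \<open>
  The constants are embedded by \<open>emb\<close> into some field \<open>'k\<close>; the function field is the
  subfield of \<open>'k\<close> generated by the constants and the coordinate functions \<open>xfun\<close> and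
  \<open>yfun\<close>. Working inside an arbitrary ambient field \<open>'k\<close> avoids a type depending on the
  curve.
\<close>

record ('c, 'k) fun_field =
  emb :: "'c \<Rightarrow> 'k"
  xfun :: 'k
  yfun :: 'k

definition subst2 :: "('c::field \<Rightarrow> 'k::field) \<Rightarrow> 'c poly poly \<Rightarrow> 'k \<Rightarrow> 'k \<Rightarrow> 'k"
  where "subst2 i P u v = eval2 (map_poly (map_poly i) P) u v"

text \<open>
  The kernel condition says that \<open>C[x,y]/(W) \<rightarrow> 'k\<close> is injective, for \<open>W\<close> the Weierstrass
  polynomial, so that \<open>ff_carrier\<close> is the fraction field of the coordinate ring.
\<close>

definition is_function_field ::
    "'c::field weierstrass \<Rightarrow> ('c, 'k::field) fun_field \<Rightarrow> bool"
  where "is_function_field E F \<longleftrightarrow>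
    emb F 1 = 1 \<and>
    (\<forall>c d. emb F (c + d) = emb F c + emb F d) \<and>
    (\<forall>c d. emb F (c * d) = emb F c * emb F d) \<and>
    (\<forall>P. subst2 (emb F) P (xfun F) (yfun F) = 0 \<longleftrightarrow> weierstrass_poly E dvd P)"

definition ff_carrier :: "('c::field, 'k::field) fun_field \<Rightarrow> 'k set"
  where "ff_carrier F =
    {subst2 (emb F) P (xfun F) (yfun F) / subst2 (emb F) Q (xfun F) (yfun F) |P Q.
       subst2 (emb F) Q (xfun F) (yfun F) \<noteq> 0}"


section \<open>Values, local rings and valuations\<close>

text \<open>
  \<open>has_value F f \<alpha> c\<close>: the rational function \<open>f\<close> is regular at \<open>\<alpha>\<close> with value \<open>c\<close>.
  At the point \<open>[0:1:0]\<close> the affine chart with coordinates \<open>x/y\<close> and \<open>1/y\<close> is used, in which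
  that point is \<open>(0,0)\<close>.
\<close>

definition has_value_in_chart ::
    "('c::field, 'k::field) fun_field \<Rightarrow> 'k \<Rightarrow> 'k \<Rightarrow> 'c \<Rightarrow> 'c \<Rightarrow> 'k \<Rightarrow> 'c \<Rightarrow> bool"
  where "has_value_in_chart F X Y u v f c \<longleftrightarrow>
    (\<exists>P Q. eval2 Q u v \<noteq> 0 \<and>
       f = subst2 (emb F) P X Y / subst2 (emb F) Q X Y \<and>
       c = eval2 P u v / eval2 Q u v)"

fun has_value :: "('c::field, 'k::field) fun_field \<Rightarrow> 'k \<Rightarrow> 'c point \<Rightarrow> 'c \<Rightarrow> bool"
  where
    "has_value F f (Affine u v) c = has_value_in_chart F (xfun F) (yfun F) u v f c"
  | "has_value F f Infinity c =
      has_value_in_chart F (xfun F / yfun F) (1 / yfun F) 0 0 f c"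

definition local_ring :: "('c::field, 'k::field) fun_field \<Rightarrow> 'c point \<Rightarrow> 'k set"
  where "local_ring F \<alpha> = {f. \<exists>c. has_value F f \<alpha> c}"

definition max_ideal :: "('c::field, 'k::field) fun_field \<Rightarrow> 'c point \<Rightarrow> 'k set"
  where "max_ideal F \<alpha> = {f. has_value F f \<alpha> 0}"

definition uniformizer :: "('c::field, 'k::field) fun_field \<Rightarrow> 'c point \<Rightarrow> 'k \<Rightarrow> bool"
  where "uniformizer F \<alpha> t \<longleftrightarrow> max_ideal F \<alpha> = (\<lambda>g. t * g) ` local_ring F \<alpha>"

text \<open>The valuation at \<open>\<alpha>\<close>, meaningful for nonzero \<open>f\<close> in the function field.\<close>

definition valuation :: "('c::field, 'k::field) fun_field \<Rightarrow> 'c point \<Rightarrow> 'k \<Rightarrow> int"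
  where "valuation F \<alpha> f =
    (THE n. \<exists>t u. uniformizer F \<alpha> t \<and> u \<in> local_ring F \<alpha> - max_ideal F \<alpha> \<and>
                  f = u * t powi n)"


section \<open>Translation by a point\<close>

text \<open>
  \<open>\<tau>\<close> is the automorphism of the function field over the constants that is induced by
  \<open>\<alpha> \<mapsto> \<alpha> \<oplus> s\<close>, i.e. \<open>(\<tau> f)(\<alpha>) = f(\<alpha> \<oplus> s)\<close> whenever \<open>f\<close> is regular at \<open>\<alpha> \<oplus> s\<close>.
  Outside the function field \<open>\<tau>\<close> is irrelevant.
\<close>

definition translation_automorphism ::
    "'c::field weierstrass \<Rightarrow> ('c, 'k::field) fun_field \<Rightarrow> 'c point \<Rightarrow> ('k \<Rightarrow> 'k) \<Rightarrow> bool"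
  where "translation_automorphism E F s \<tau> \<longleftrightarrow>
    bij_betw \<tau> (ff_carrier F) (ff_carrier F) \<and>
    (\<forall>f\<in>ff_carrier F. \<forall>g\<in>ff_carrier F. \<tau> (f + g) = \<tau> f + \<tau> g \<and> \<tau> (f * g) = \<tau> f * \<tau> g) \<and>
    (\<forall>c. \<tau> (emb F c) = emb F c) \<and>
    (\<forall>f\<in>ff_carrier F. \<forall>\<alpha>\<in>curve_points E. \<forall>c.
       has_value F f (curve_add E \<alpha> s) c \<longrightarrow> has_value F (\<tau> f) \<alpha> c)"

definition orbits :: "'c::field weierstrass \<Rightarrow> 'c point \<Rightarrow> 'c point set set"
  where "orbits E s = rcosets\<^bsub>curve_group E\<^esub> (range (\<lambda>n::int. s [^]\<^bsub>curve_group E\<^esub> n))"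

text \<open>\<open>shift E s \<alpha> n\<close> is \<open>\<alpha> \<oplus> n s\<close>.\<close>

definition shift :: "'c::field weierstrass \<Rightarrow> 'c point \<Rightarrow> 'c point \<Rightarrow> int \<Rightarrow> 'c point"
  where "shift E s \<alpha> n = \<alpha> \<otimes>\<^bsub>curve_group E\<^esub> (s [^]\<^bsub>curve_group E\<^esub> n)"

text \<open>
  Sums over infinite index sets with finite support are written with the library's
  \<open>sum'\<close> and \<open>gfinprod\<close>, which restrict the sum to the indices with a nonzero
  (non-neutral) summand.
\<close>

end

theory Submission
  imports Defs
begin

text \<open>
  Modulo constants, functions are determined by their divisors, and \<open>\<tau>\<close> shifts divisors by \<open>s\<close>. So
  \<open>a = c * (\<tau> r / r)\<close> is solvable iff the divisor of \<open>a\<close> is \<open>D (P \<oplus> s) - D P\<close> for some principal \<open>D\<close>.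
  Condition (1) says that this difference equation has a finitely supported solution on every orbit;
  summation by parts turns (2) and (3) into \<open>deg D = 0\<close> and \<open>\<Sum> D P \<cdot> P = o\<close>, which by Abel's theorem
  characterise the principal \<open>D\<close>.

  Abel's theorem and the group axioms come from the same facts. Every element of the coordinate ring
  is uniquely \<open>A(x) + B(x) y\<close>; its norm to \<open>C[x]\<close> counts its zeros, and the degree of the norm,
  \<open>max (2 deg A) (2 deg B + 3)\<close>, is its pole order at infinity. As this degree is never 1, \<open>P \<noteq> Q\<close>
  are never linearly equivalent. The chord construction shows \<open>P + Q \<sim> (P \<oplus> Q) + o\<close>, so
  associativity can be checked on divisor classes.
\<close>

section \<open>Substitution into polynomials\<close>

text \<open>The definitions provide neither the group axioms, nor a uniformizer at any point, nor
  the effect of \<open>\<tau>\<close> on valuations. As \<open>valuation\<close> is a definite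
  description, orders are handled as a relation: uniqueness is formal, but existence needs an
  explicit parameter at each point. This is \<open>x - u\<close> where the vertical line meets the
  curve in two distinct points, \<open>y - v\<close> at a point fixed by negation (the place where
  nonsingularity enters), and \<open>x / y\<close> at infinity. As \<open>s\<close> is non-torsion,
  each orbit is a copy of the integers. There a solution D that vanishes far to the left must be the
  sequence of partial sums of the divisor of \<open>a\<close>, and (1) says that these sums return
  to 0. The weights in (2) and (3) come from summation by parts, which replaces a weight w(n) by w(n
  - 1) - w(n): the weights 1, n and n(n + 1)/2 become 0, -1 and -n. The last two are what is needed
  to split the multiples of \<open>rep \<omega> \<oplus> n s\<close> in the group sum of D into a
  part along \<open>rep \<omega>\<close> and a part along \<open>s\<close>.\<close>

lemma eval2_0 [simp]: "eval2 0 u v = 0"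
  and eval2_pCons [simp]: "eval2 (pCons A P) u v = poly A u + v * eval2 P u v"
  and eval2_add [simp]: "eval2 (P + Q) u v = eval2 P u v + eval2 Q u v"
  and eval2_diff [simp]: "eval2 (P - Q) u v = eval2 P u v - eval2 Q u v"
  and eval2_mult [simp]: "eval2 (P * Q) u v = eval2 P u v * eval2 Q u v"
  and eval2_1 [simp]: "eval2 1 u v = 1"
  by (simp_all add: eval2_def)

section \<open>Field embeddings and evaluation along them\<close>

locale field_embedding =
  fixes \<iota> :: "'c::field \<Rightarrow> 'k::field"
  assumes hom_1 [simp]: "\<iota> 1 = 1"
    and hom_add [simp]: "\<iota> (c + d) = \<iota> c + \<iota> d"
    and hom_mult [simp]: "\<iota> (c * d) = \<iota> c * \<iota> d"
begin

lemma hom_0 [simp]: "\<iota> 0 = 0"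
  by (metis add_0 add_cancel_right_right hom_add)

lemma hom_minus [simp]: "\<iota> (- c) = - \<iota> c"
proof -
  have "\<iota> c + \<iota> (- c) = 0"
    by (simp flip: hom_add)
  then show ?thesis
    by (simp add: eq_neg_iff_add_eq_0 add.commute)
qed

lemma hom_diff [simp]: "\<iota> (c - d) = \<iota> c - \<iota> d"
  using hom_add[of c "- d"] by simp

lemma hom_eq_0_iff [simp]: "\<iota> c = 0 \<longleftrightarrow> c = 0"
proof
  assume "\<iota> c = 0"
  then have "\<iota> (c * inverse c) = 0"
    by simp
  then show "c = 0"
    by (metis hom_1 right_inverse zero_neq_one)
qed simp

lemma hom_inverse [simp]: "\<iota> (inverse c) = inverse (\<iota> c)"
proof (cases "c = 0")
  case False
  then have "\<iota> c * \<iota> (inverse c) = 1"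
    by (simp flip: hom_mult)
  then show ?thesis
    by (simp add: inverse_unique)
qed simp

definition subst1 :: "'k \<Rightarrow> 'c poly \<Rightarrow> 'k"
  where "subst1 u p = poly (map_poly \<iota> p) u"

lemma subst1_0 [simp]: "subst1 u 0 = 0"
  and subst1_pCons [simp]: "subst1 u (pCons c p) = \<iota> c + u * subst1 u p"
  by (simp_all add: subst1_def map_poly_pCons)

lemma subst1_add [simp]: "subst1 u (p + q) = subst1 u p + subst1 u q"
proof (induction p arbitrary: q)
  case (pCons a p)
  then show ?case
    by (cases q) (simp add: algebra_simps)
qed simp

lemma subst1_smult [simp]: "subst1 u (smult c p) = \<iota> c * subst1 u p"
  by (induction p) (simp_all add: algebra_simps)

lemma subst1_mult [simp]: "subst1 u (p * q) = subst1 u p * subst1 u q"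
  by (induction p) (simp_all add: algebra_simps)

lemma subst1_minus [simp]: "subst1 u (- p) = - subst1 u p"
  by (induction p) (simp_all add: algebra_simps)

lemma subst1_diff [simp]: "subst1 u (p - q) = subst1 u p - subst1 u q"
  using subst1_add[of u p "- q"] by simp

lemma subst1_1 [simp]: "subst1 u 1 = 1"
  by (simp add: one_pCons)

lemma subst1_power [simp]: "subst1 u (p ^ n) = subst1 u p ^ n"
  by (induction n) simp_all

lemma subst2_0 [simp]: "subst2 \<iota> 0 u v = 0"
  and subst2_pCons [simp]: "subst2 \<iota> (pCons A P) u v = subst1 u A + v * subst2 \<iota> P u v"
  by (simp_all add: subst2_def map_poly_pCons subst1_def)

lemma subst2_add [simp]: "subst2 \<iota> (P + Q) u v = subst2 \<iota> P u v + subst2 \<iota> Q u v"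
proof (induction P arbitrary: Q)
  case (pCons a P)
  then show ?case
    by (cases Q) (simp add: algebra_simps)
qed simp

lemma subst2_smult [simp]: "subst2 \<iota> (smult A P) u v = subst1 u A * subst2 \<iota> P u v"
  by (induction P) (simp_all add: algebra_simps)

lemma subst2_mult [simp]: "subst2 \<iota> (P * Q) u v = subst2 \<iota> P u v * subst2 \<iota> Q u v"
  by (induction P) (simp_all add: algebra_simps)

lemma subst2_minus [simp]: "subst2 \<iota> (- P) u v = - subst2 \<iota> P u v"
  by (induction P) (simp_all add: algebra_simps)

lemma subst2_diff [simp]: "subst2 \<iota> (P - Q) u v = subst2 \<iota> P u v - subst2 \<iota> Q u v"
  using subst2_add[of P "- Q" u v] by simp

lemma subst2_1 [simp]: "subst2 \<iota> 1 u v = 1"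
  by (simp add: one_pCons)

end

section \<open>Places and valuations\<close>

text \<open>Of \<open>t\<close> only a value 0 and \<open>t \<noteq> 0\<close> are required; whether
  it generates the maximal ideal is the separate assumption \<open>has_ord_exists\<close> of
  \<open>curve_place\<close>. Thus \<open>x - emb F u\<close> and \<open>y - emb F v\<close> both
  give a place at every affine point of the curve, ramified or not.\<close>

locale place =
  fixes \<iota> :: "'c::field \<Rightarrow> 'k::field" and hv :: "'k \<Rightarrow> 'c \<Rightarrow> bool" and t :: 'k
  assumes hv_unique: "hv f c \<Longrightarrow> hv f d \<Longrightarrow> c = d"
    and hv_add: "hv f c \<Longrightarrow> hv g d \<Longrightarrow> hv (f + g) (c + d)"
    and hv_mult: "hv f c \<Longrightarrow> hv g d \<Longrightarrow> hv (f * g) (c * d)"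
    and hv_inverse: "hv f c \<Longrightarrow> c \<noteq> 0 \<Longrightarrow> hv (inverse f) (inverse c)"
    and hv_const: "hv (\<iota> c) c"
    and hom0: "\<iota> 0 = 0" and hom1: "\<iota> 1 = 1"
    and hv_t: "hv t 0" and t_nz: "t \<noteq> 0"
begin

text \<open>A relation instead of a function, so that orders can be computed before every nonzero
  function is known to have one.\<close>

definition has_ord :: "'k \<Rightarrow> int \<Rightarrow> bool"
  where "has_ord f n \<longleftrightarrow> (\<exists>u c. hv u c \<and> c \<noteq> 0 \<and> f = u * t powi n)"

lemma hv_0: "hv 0 0" and hv_1: "hv 1 1"
  using hv_const[of 0] hv_const[of 1] by (simp_all add: hom0 hom1)

lemma hv_nonzero: "hv u c \<Longrightarrow> c \<noteq> 0 \<Longrightarrow> u \<noteq> 0"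
  using hv_unique hv_0 by blast

lemma hv_t_power: "n > 0 \<Longrightarrow> hv (t ^ n) 0"
proof (induction n)
  case (Suc n)
  then show ?case
    by (cases "n = 0") (use hv_mult[OF hv_t] hv_t in auto)
qed simp

lemma hv_t_powi: "n > 0 \<Longrightarrow> hv (t powi n) 0"
  using hv_t_power[of "nat n"] by (simp add: power_int_def)

lemma has_ord_nonzero: "has_ord f n \<Longrightarrow> f \<noteq> 0"
  unfolding has_ord_def using hv_nonzero t_nz by auto

lemma has_ord_unit: "hv u c \<Longrightarrow> c \<noteq> 0 \<Longrightarrow> has_ord u 0"
  unfolding has_ord_def by fastforce

lemma has_ord_t: "has_ord t 1"
  unfolding has_ord_def using hv_1 by fastforce

lemma has_ord_mult: "has_ord f m \<Longrightarrow> has_ord g n \<Longrightarrow> has_ord (f * g) (m + n)"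
  unfolding has_ord_def
proof clarify
  fix u c w d
  assume *: "hv u c" "c \<noteq> 0" "hv w d" "d \<noteq> 0"
  then show "\<exists>z e. hv z e \<and> e \<noteq> 0 \<and> u * t powi m * (w * t powi n) = z * t powi (m + n)"
    using t_nz by (intro exI[of _ "u * w"] exI[of _ "c * d"])
      (auto simp: hv_mult power_int_add algebra_simps)
qed

lemma has_ord_inverse: "has_ord f m \<Longrightarrow> has_ord (inverse f) (- m)"
  unfolding has_ord_def
proof clarify
  fix u c
  assume *: "hv u c" "c \<noteq> 0"
  then show "\<exists>z e. hv z e \<and> e \<noteq> 0 \<and> inverse (u * t powi m) = z * t powi (- m)"
    by (intro exI[of _ "inverse u"] exI[of _ "inverse c"])
      (auto simp: hv_inverse power_int_minus)
qed

lemma has_ord_divide: "has_ord f m \<Longrightarrow> has_ord g n \<Longrightarrow> has_ord (f / g) (m - n)"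
  using has_ord_mult[OF _ has_ord_inverse] by (simp add: divide_inverse)

lemma has_ord_power: "has_ord f m \<Longrightarrow> has_ord (f ^ n) (int n * m)"
proof (induction n)
  case 0
  then show ?case using has_ord_unit[OF hv_1] by simp
next
  case (Suc n)
  then show ?case using has_ord_mult[of f m "f ^ n" "int n * m"] by (simp add: algebra_simps)
qed

lemma has_ord_pos_hv:
  assumes "has_ord f n" "n > 0"
  shows "hv f 0"
  using assms hv_mult[OF _ hv_t_powi] unfolding has_ord_def by fastforce

lemma has_ord_unit_hv: "has_ord f 0 \<Longrightarrow> \<exists>c. hv f c \<and> c \<noteq> 0"
  unfolding has_ord_def by auto

text \<open>Two different orders would give 1 = f / f a positive order and hence the value
  0.\<close>

lemma has_ord_unique:
  assumes "has_ord f m" "has_ord f n"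
  shows "m = n"
proof -
  have *: False if "has_ord f m" "has_ord f n" "m < n" for m n
  proof -
    have "has_ord (f / f) (n - m)"
      using that has_ord_divide by blast
    then have "hv 1 0"
      using has_ord_pos_hv[of 1 "n - m"] has_ord_nonzero[OF that(1)] that(3) by simp
    then show False
      using hv_1 hv_unique by fastforce
  qed
  then show ?thesis
    using assms by (metis linorder_neqE)
qed

lemma has_ord_nonneg_hv:
  assumes "has_ord f n" "n \<ge> 0"
  shows "\<exists>c. hv f c"
  using has_ord_pos_hv[OF assms(1)] has_ord_unit_hv assms by (cases "n = 0") auto

lemma hv_has_ord_nonneg:
  assumes "has_ord f n" "hv f c"
  shows "n \<ge> 0"
proof (rule ccontr)
  assume "\<not> n \<ge> 0"
  then have "hv (inverse f) 0"
    using has_ord_pos_hv[OF has_ord_inverse[OF assms(1)]] by simp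
  from hv_mult[OF assms(2) this] have "hv 1 0"
    using has_ord_nonzero[OF assms(1)] by simp
  then show False
    using hv_1 hv_unique by fastforce
qed

lemma hv_0_has_ord_pos:
  assumes "has_ord f n" "hv f 0"
  shows "n > 0"
  using hv_has_ord_nonneg[OF assms] has_ord_unit_hv[of f] assms hv_unique
  by (cases "n = 0") auto

text \<open>The sum is f (1 + g / f), and g / f vanishes at the place, so the second factor is a
  unit.\<close>

lemma has_ord_add:
  assumes "has_ord f m" "has_ord g n" "m < n"
  shows "has_ord (f + g) m"
proof -
  have "hv (g / f) 0"
    using has_ord_pos_hv[OF has_ord_divide[OF assms(2,1)]] assms(3) by simp
  from hv_add[OF hv_1 this] have "has_ord (1 + g / f) 0"
    using has_ord_unit by fastforce
  from has_ord_mult[OF assms(1) this] show ?thesis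
    using has_ord_nonzero[OF assms(1)] by (simp add: algebra_simps)
qed

end

text \<open>The existence of orders expresses that the local ring is a discrete valuation ring with
  parameter \<open>t\<close>.\<close>

locale curve_place = place "emb F" "\<lambda>f. has_value F f \<alpha>" t
  for F :: "('c::field, 'k::field) fun_field" and \<alpha> :: "'c point" and t :: 'k +
  assumes hv_closed: "has_value F f \<alpha> c \<Longrightarrow> f \<in> ff_carrier F"
    and has_ord_exists: "f \<in> ff_carrier F \<Longrightarrow> f \<noteq> 0 \<Longrightarrow> \<exists>n. has_ord f n"
begin

lemma local_ring_iff: "has_ord f n \<Longrightarrow> f \<in> local_ring F \<alpha> \<longleftrightarrow> n \<ge> 0"
  using has_ord_nonneg_hv hv_has_ord_nonneg unfolding local_ring_def by blast

lemma max_ideal_iff: "has_ord f n \<Longrightarrow> f \<in> max_ideal F \<alpha> \<longleftrightarrow> n > 0"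
  using has_ord_pos_hv hv_0_has_ord_pos unfolding max_ideal_def by blast

lemma zero_in_ideal: "0 \<in> max_ideal F \<alpha>" "0 \<in> local_ring F \<alpha>"
  using hv_0 by (auto simp: max_ideal_def local_ring_def)

lemma has_ord_exists_local: "f \<in> local_ring F \<alpha> \<Longrightarrow> f \<noteq> 0 \<Longrightarrow> \<exists>n. has_ord f n"
  using hv_closed has_ord_exists unfolding local_ring_def by blast

lemma max_ideal_local: "f \<in> max_ideal F \<alpha> \<Longrightarrow> f \<in> local_ring F \<alpha>"
  unfolding local_ring_def max_ideal_def by blast

text \<open>If t' generates the maximal ideal, then \<open>t = t' * g\<close> with g regular, so 1
  is the sum of a positive and a nonnegative order. Consequently the definite description in
  \<open>valuation\<close> does not depend on the chosen uniformizer.\<close>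

lemma uniformizer_iff: "uniformizer F \<alpha> t' \<longleftrightarrow> has_ord t' 1"
proof
  assume u: "uniformizer F \<alpha> t'"
  have "t \<in> max_ideal F \<alpha>"
    using hv_t by (simp add: max_ideal_def)
  then obtain g where g: "g \<in> local_ring F \<alpha>" "t = t' * g"
    using u by (auto simp: uniformizer_def)
  have "t' \<in> max_ideal F \<alpha>"
    using u local_ring_def hv_1 by (force simp: uniformizer_def)
  moreover have "g \<noteq> 0" "t' \<noteq> 0"
    using g t_nz by auto
  ultimately obtain m n where mn: "has_ord g m" "has_ord t' n"
    using g has_ord_exists_local max_ideal_local by blast
  then have "n > 0" "m \<ge> 0"
    using g(1) \<open>t' \<in> _\<close> local_ring_iff max_ideal_iff by auto
  moreover have "n + m = 1"
    using has_ord_mult[OF mn(2,1)] g(2) has_ord_t has_ord_unique by auto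
  ultimately show "has_ord t' 1"
    using mn by (cases "n = 1") auto
next
  assume t': "has_ord t' 1"
  have "f \<in> (*) t' ` local_ring F \<alpha>" if f: "f \<in> max_ideal F \<alpha>" for f
  proof (cases "f = 0")
    case True
    then show ?thesis
      using zero_in_ideal by force
  next
    case False
    then obtain n where n: "has_ord f n"
      using f has_ord_exists_local max_ideal_local by blast
    have "has_ord (f / t') (n - 1)"
      using n t' has_ord_divide by blast
    moreover have "n > 0"
      using f n max_ideal_iff by blast
    ultimately have "f / t' \<in> local_ring F \<alpha>"
      using local_ring_iff by auto
    moreover have "f = t' * (f / t')"
      using has_ord_nonzero[OF t'] by simp
    ultimately show ?thesis
      by blast
  qed
  moreover have "t' * f \<in> max_ideal F \<alpha>" if "f \<in> local_ring F \<alpha>" for f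
    using that has_ord_pos_hv[OF t'] hv_mult[of t' 0 f]
    by (auto simp: local_ring_def max_ideal_def)
  ultimately show "uniformizer F \<alpha> t'"
    unfolding uniformizer_def by blast
qed

lemma valuation_eq:
  assumes "has_ord f n"
  shows "valuation F \<alpha> f = n"
  unfolding valuation_def
proof (rule the_equality)
  show "\<exists>t u. uniformizer F \<alpha> t \<and> u \<in> local_ring F \<alpha> - max_ideal F \<alpha> \<and> f = u * t powi n"
  proof -
    obtain u c where u: "has_value F u \<alpha> c" "c \<noteq> 0" "f = u * t powi n"
      using assms has_ord_def by auto
    then show ?thesis
      using has_ord_unit[OF u(1,2)] local_ring_iff max_ideal_iff uniformizer_iff has_ord_t
      by (intro exI[of _ t] exI[of _ u]) auto
  qed
next
  fix k
  assume "\<exists>t u. uniformizer F \<alpha> t \<and> u \<in> local_ring F \<alpha> - max_ideal F \<alpha> \<and> f = u * t powi k"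
  then obtain t' u where *: "has_ord t' 1" "u \<in> local_ring F \<alpha>" "u \<notin> max_ideal F \<alpha>"
    "f = u * t' powi k"
    by (auto simp: uniformizer_iff)
  then obtain m where m: "has_ord u m"
    using zero_in_ideal has_ord_exists_local[of u] by metis
  have "m = 0"
    using m * local_ring_iff max_ideal_iff by force
  moreover have "has_ord (t' powi k) k"
  proof (cases "k \<ge> 0")
    case True
    then show ?thesis
      using has_ord_power[OF *(1), of "nat k"] by (simp add: power_int_def)
  next
    case False
    then show ?thesis
      using has_ord_power[OF has_ord_inverse[OF *(1)], of "nat (- k)"]
      by (simp add: power_int_def)
  qed
  ultimately have "has_ord f k"
    using has_ord_mult[OF m] *(4) by fastforce
  then show "k = n"
    using assms has_ord_unique by blast
qed

lemma has_ord_valuation: "f \<in> ff_carrier F \<Longrightarrow> f \<noteq> 0 \<Longrightarrow> has_ord f (valuation F \<alpha> f)"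
  using has_ord_exists valuation_eq by blast

end

section \<open>Normal forms and the norm\<close>

locale chart = field_embedding "emb F"
  for F :: "('c::field, 'k::field) fun_field" +
  fixes X Y :: 'k and u v :: 'c
  assumes specialize: "subst2 (emb F) P X Y = 0 \<Longrightarrow> eval2 P u v = 0"
begin

abbreviation hv where "hv \<equiv> has_value_in_chart F X Y u v"

lemma subst2_nonzero: "eval2 P u v \<noteq> 0 \<Longrightarrow> subst2 (emb F) P X Y \<noteq> 0"
  using specialize by blast

lemma hvI:
  assumes "eval2 Q u v \<noteq> 0" "f * subst2 (emb F) Q X Y = subst2 (emb F) P X Y"
    "c * eval2 Q u v = eval2 P u v"
  shows "hv f c"
  unfolding has_value_in_chart_def
  using assms subst2_nonzero[OF assms(1)]
  by (intro exI[of _ P] exI[of _ Q]) (auto simp: field_simps)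

lemma hvE:
  assumes "hv f c"
  obtains P Q where "eval2 Q u v \<noteq> 0" "subst2 (emb F) Q X Y \<noteq> 0"
    "f = subst2 (emb F) P X Y / subst2 (emb F) Q X Y" "c = eval2 P u v / eval2 Q u v"
  using assms subst2_nonzero unfolding has_value_in_chart_def by blast

lemma hv_subst2: "hv (subst2 (emb F) P X Y) (eval2 P u v)"
  by (rule hvI[of 1]) auto

lemma hv_emb: "hv (emb F c) c"
  using hv_subst2[of "[:[:c:]:]"] by simp

text \<open>Cross-multiplying two fractions for f gives a polynomial relation between
  \<open>X\<close> and \<open>Y\<close>; \<open>specialize\<close> carries it over to
  \<open>u\<close> and \<open>v\<close>.\<close>

lemma hv_unique:
  assumes "hv f c" "hv f d"
  shows "c = d"
proof -
  obtain P Q where P: "eval2 Q u v \<noteq> 0" "subst2 (emb F) Q X Y \<noteq> 0"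
    "f = subst2 (emb F) P X Y / subst2 (emb F) Q X Y" "c = eval2 P u v / eval2 Q u v"
    using assms(1) hvE by blast
  obtain R S where R: "eval2 S u v \<noteq> 0" "subst2 (emb F) S X Y \<noteq> 0"
    "f = subst2 (emb F) R X Y / subst2 (emb F) S X Y" "d = eval2 R u v / eval2 S u v"
    using assms(2) hvE by blast
  have "subst2 (emb F) (P * S - R * Q) X Y = 0"
    using P(2,3) R(2,3) by (simp add: field_simps)
  then have "eval2 (P * S - R * Q) u v = 0"
    by (rule specialize)
  then show ?thesis
    using P(1,4) R(1,4) by (simp add: frac_eq_eq)
qed

lemma hv_add:
  assumes "hv f c" "hv g d"
  shows "hv (f + g) (c + d)"
proof -
  obtain P Q where P: "eval2 Q u v \<noteq> 0" "subst2 (emb F) Q X Y \<noteq> 0"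
    "f = subst2 (emb F) P X Y / subst2 (emb F) Q X Y" "c = eval2 P u v / eval2 Q u v"
    using assms(1) hvE by blast
  obtain R S where R: "eval2 S u v \<noteq> 0" "subst2 (emb F) S X Y \<noteq> 0"
    "g = subst2 (emb F) R X Y / subst2 (emb F) S X Y" "d = eval2 R u v / eval2 S u v"
    using assms(2) hvE by blast
  show ?thesis
    by (rule hvI[of "Q * S" _ "P * S + R * Q"])
      (use P(1,2) R(1,2) in \<open>simp_all add: P(3,4) R(3,4) add_frac_eq\<close>)
qed

lemma hv_mult:
  assumes "hv f c" "hv g d"
  shows "hv (f * g) (c * d)"
proof -
  obtain P Q where P: "eval2 Q u v \<noteq> 0" "subst2 (emb F) Q X Y \<noteq> 0"
    "f = subst2 (emb F) P X Y / subst2 (emb F) Q X Y" "c = eval2 P u v / eval2 Q u v"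
    using assms(1) hvE by blast
  obtain R S where R: "eval2 S u v \<noteq> 0" "subst2 (emb F) S X Y \<noteq> 0"
    "g = subst2 (emb F) R X Y / subst2 (emb F) S X Y" "d = eval2 R u v / eval2 S u v"
    using assms(2) hvE by blast
  show ?thesis
    by (rule hvI[of "Q * S" _ "P * R"])
      (use P(1,2) R(1,2) in \<open>simp_all add: P(3,4) R(3,4)\<close>)
qed

lemma hv_inverse:
  assumes "hv f c" "c \<noteq> 0"
  shows "hv (inverse f) (inverse c)"
proof -
  obtain P Q where P: "eval2 Q u v \<noteq> 0" "subst2 (emb F) Q X Y \<noteq> 0"
    "f = subst2 (emb F) P X Y / subst2 (emb F) Q X Y" "c = eval2 P u v / eval2 Q u v"
    using assms(1) hvE by blast
  then have "eval2 P u v \<noteq> 0"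
    using assms(2) by auto
  then show ?thesis
    using P(1,2) subst2_nonzero[of P] by (intro hvI[of P _ Q]) (simp_all add: P(3,4))
qed

end

section \<open>The coordinate ring and its norm\<close>

locale elliptic_function_field =
  fixes E :: "'c::alg_closed_field weierstrass" and F :: "('c, 'k::field) fun_field"
  assumes elliptic: "elliptic_curve E" and function_field: "is_function_field E F"
begin

sublocale field_embedding "emb F"
  using function_field by unfold_locales (auto simp: is_function_field_def)

abbreviation x :: 'k where "x \<equiv> xfun F"
abbreviation y :: 'k where "y \<equiv> yfun F"
abbreviation K :: "'k set" where "K \<equiv> ff_carrier F"

definition h :: "'c poly" where "h = [:A3 E, A1 E:]"
definition cubic :: "'c poly" where "cubic = [:A6 E, A4 E, A2 E, 1:]"

lemma weierstrass_poly_eq: "weierstrass_poly E = [: - cubic, h, 1 :]"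
  by (simp add: weierstrass_poly_def h_def cubic_def)

lemma degree_cubic [simp]: "degree cubic = 3" and cubic_nonzero [simp]: "cubic \<noteq> 0"
  and degree_h: "degree h \<le> 1"
  by (simp_all add: cubic_def h_def)

lemma subst2_eq_0_iff: "subst2 (emb F) P x y = 0 \<longleftrightarrow> weierstrass_poly E dvd P"
  using function_field by (simp add: is_function_field_def)

lemma curve_equation: "y * y = subst1 x cubic - subst1 x h * y"
proof -
  have "subst2 (emb F) (weierstrass_poly E) x y = 0"
    by (simp add: subst2_eq_0_iff)
  then have "y * y - (subst1 x cubic - subst1 x h * y) = 0"
    by (simp add: weierstrass_poly_eq algebra_simps)
  then show ?thesis
    by simp
qed

definition lin :: "'c poly \<Rightarrow> 'c poly \<Rightarrow> 'k"
  where "lin A B = subst1 x A + subst1 x B * y"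

text \<open>A relation would be a multiple of the Weierstrass polynomial, which has degree 2 in y,
  whereas A + B y has degree at most 1.\<close>

lemma lin_eq_0_iff [simp]: "lin A B = 0 \<longleftrightarrow> A = 0 \<and> B = 0"
proof
  assume "lin A B = 0"
  then have "weierstrass_poly E dvd [:A, B:]"
    by (simp add: lin_def algebra_simps flip: subst2_eq_0_iff)
  then have "[:A, B:] = 0 \<or> 2 \<le> degree [:A, B:]"
    using dvd_imp_degree_le by (fastforce simp: weierstrass_poly_eq)
  moreover have "degree [:A, B:] \<le> 1"
    by simp
  ultimately show "A = 0 \<and> B = 0"
    by auto
qed (simp add: lin_def)

lemma lin_add: "lin A B + lin C D = lin (A + C) (B + D)"
  and lin_diff: "lin A B - lin C D = lin (A - C) (B - D)"
  by (simp_all add: lin_def algebra_simps)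

lemma lin_inject: "lin A B = lin C D \<longleftrightarrow> A = C \<and> B = D"
  using lin_diff[of A B C D] by (metis eq_iff_diff_eq_0 lin_eq_0_iff)

lemma subst1_lin: "subst1 x A = lin A 0" and y_lin: "y = lin 0 1"
  by (simp_all add: lin_def)

lemma subst1_eq_0_iff [simp]: "subst1 x A = 0 \<longleftrightarrow> A = 0"
  by (simp add: subst1_lin)

lemma y_nonzero [simp]: "y \<noteq> 0"
  by (simp add: y_lin)

lemma x_lin: "x = lin [:0, 1:] 0" and emb_lin: "emb F c = lin [:c:] 0"
  by (simp_all add: lin_def)

lemma lin_mult:
  "lin A B * lin C D = lin (A * C + B * D * cubic) (A * D + B * C - B * D * h)"
proof -
  have "lin A B * lin C D = subst1 x A * subst1 x C + subst1 x B * subst1 x D * (y * y)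
     + (subst1 x A * subst1 x D + subst1 x B * subst1 x C) * y"
    unfolding lin_def by (simp add: algebra_simps)
  then show ?thesis
    unfolding curve_equation by (simp add: lin_def algebra_simps)
qed

lemma subst2_lin_ex: "\<exists>A B. subst2 (emb F) P x y = lin A B"
proof (induction P)
  case 0
  have "subst2 (emb F) 0 x y = lin 0 0"
    by (simp add: lin_def)
  then show ?case
    by blast
next
  case (pCons A P)
  then obtain C D where "subst2 (emb F) P x y = lin C D"
    by blast
  then have "subst2 (emb F) (pCons A P) x y = lin A 0 + lin 0 1 * lin C D"
    by (simp add: subst1_lin y_lin)
  then show ?case
    by (metis lin_add lin_mult)
qed

lemma lin_subst2: "lin A B = subst2 (emb F) [:A, B:] x y"
  by (simp add: lin_def mult.commute)

text \<open>The product of A + B y with its conjugate under y \<mapsto> - y - h(x), the substitution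
  that comes from negation on the curve.\<close>

definition nrm :: "'c poly \<Rightarrow> 'c poly \<Rightarrow> 'c poly"
  where "nrm A B = A * A - A * B * h - B * B * cubic"

lemma lin_conj: "lin A B * lin (A - h * B) (- B) = subst1 x (nrm A B)"
  unfolding lin_mult subst1_lin nrm_def lin_inject by (simp add: algebra_simps)

lemma norm_conj: "nrm (A - h * B) (- B) = nrm A B"
  unfolding nrm_def by (simp add: algebra_simps)

lemma norm_mult:
  "nrm (A * C + B * D * cubic) (A * D + B * C - B * D * h) = nrm A B * nrm C D"
  unfolding nrm_def by algebra

lemma norm_subst1: "nrm A 0 = A * A"
  by (simp add: nrm_def)

text \<open>The outer terms A^2 and B^2 \<open>cubic\<close> have degrees of different parity, so
  they cannot cancel; the mixed term has degree at most deg A + deg B + 1, which is below the larger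
  of the two.\<close>

lemma
  assumes "A \<noteq> 0 \<or> B \<noteq> 0"
  shows norm_nonzero: "nrm A B \<noteq> 0"
    and degree_norm:
      "degree (nrm A B) = max (2 * degree A) (if B = 0 then 0 else 2 * degree B + 3)"
proof -
  have conj: "A - h * B \<noteq> 0 \<or> - B \<noteq> 0"
    using assms by auto
  show "nrm A B \<noteq> 0"
    using lin_conj[of A B] assms conj by (metis lin_eq_0_iff mult_eq_0_iff subst1_0)
  show "degree (nrm A B) = max (2 * degree A) (if B = 0 then 0 else 2 * degree B + 3)"
  proof (cases "A = 0 \<or> B = 0")
    case True
    then show ?thesis
      using assms by (auto simp: nrm_def degree_mult_eq)
  next
    case False
    have a: "degree (A * A) = 2 * degree A" and b: "degree (B * B * cubic) = 2 * degree B + 3"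
      using False by (simp_all add: degree_mult_eq)
    have c: "degree (A * B * h) \<le> degree A + degree B + 1"
      using False degree_h by (intro order.trans[OF degree_mult_le]) (simp add: degree_mult_eq)
    show ?thesis
    proof (cases "2 * degree A < 2 * degree B + 3")
      case True
      then have "degree (A * A - A * B * h) < degree (B * B * cubic)"
        unfolding b by (intro degree_diff_less) (use a c in auto)
      then have "degree (nrm A B) = degree (B * B * cubic)"
        using degree_add_eq_right[of "A * A - A * B * h" "- (B * B * cubic)"] unfolding nrm_def by simp
      then show ?thesis
        using b False True by simp
    next
      case False
      then have "degree (A * B * h + B * B * cubic) < degree (A * A)"
        unfolding a by (intro degree_add_less) (use c b in presburger)+
      then show ?thesis
        using False a \<open>\<not> (A = 0 \<or> B = 0)\<close> degree_add_eq_left[of "- (A * B * h + B * B * cubic)" "A * A"]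
        unfolding nrm_def degree_minus by (simp add: diff_diff_eq del: minus_add_distrib)
    qed
  qed
qed

lemma norm_eq_0_iff [simp]: "nrm A B = 0 \<longleftrightarrow> A = 0 \<and> B = 0"
  using norm_nonzero by (auto simp: nrm_def)

text \<open>Expanding the fraction by the conjugate of its denominator turns the denominator into a
  norm, a polynomial in x alone.\<close>

lemma ff_carrierE:
  assumes "f \<in> K"
  obtains A B D where "D \<noteq> 0" "f = lin A B / subst1 x D"
proof -
  obtain A B C D where f: "f = lin A B / lin C D" and nz: "lin C D \<noteq> 0"
    using assms subst2_lin_ex unfolding ff_carrier_def mem_Collect_eq by metis
  then have "lin (C - h * D) (- D) \<noteq> 0"
    by auto
  then have "f = (lin A B * lin (C - h * D) (- D)) / (lin C D * lin (C - h * D) (- D))"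
    using f nz by simp
  moreover have "nrm C D \<noteq> 0"
    using nz by simp
  ultimately show ?thesis
    using that lin_conj lin_mult by metis
qed

section \<open>The function field is closed under the field operations\<close>

lemma ff_carrierI: "lin C D \<noteq> 0 \<Longrightarrow> lin A B / lin C D \<in> K"
  unfolding ff_carrier_def lin_subst2 by blast

lemma lin_in_K: "lin A B \<in> K"
  using ff_carrierI[of 1 0 A B] by (simp add: lin_def)

lemma subst1_in_K [simp]: "subst1 x A \<in> K"
  by (simp add: subst1_lin lin_in_K)

lemma x_in_K [simp]: "x \<in> K" and y_in_K [simp]: "y \<in> K" and emb_in_K [simp]: "emb F c \<in> K"
  unfolding x_lin y_lin emb_lin by (rule lin_in_K)+

lemma zero_in_K [simp]: "0 \<in> K" and one_in_K [simp]: "1 \<in> K"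
  using emb_in_K[of 0] emb_in_K[of 1] by simp_all

lemma add_in_K [simp]: "f \<in> K \<Longrightarrow> g \<in> K \<Longrightarrow> f + g \<in> K"
proof (elim ff_carrierE)
  fix A B D A' B' D'
  assume *: "D \<noteq> 0" "f = lin A B / subst1 x D" "D' \<noteq> 0" "g = lin A' B' / subst1 x D'"
  have "f + g = (lin A B * lin D' 0 + lin A' B' * lin D 0) / lin (D * D') 0"
    using *(1,3) by (simp add: *(2,4) add_frac_eq flip: subst1_lin)
  then show "f + g \<in> K"
    using *(1,3) ff_carrierI[of "D * D'" 0] by (simp add: lin_mult lin_add)
qed

lemma mult_in_K [simp]: "f \<in> K \<Longrightarrow> g \<in> K \<Longrightarrow> f * g \<in> K"
proof (elim ff_carrierE)
  fix A B D A' B' D'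
  assume *: "D \<noteq> 0" "f = lin A B / subst1 x D" "D' \<noteq> 0" "g = lin A' B' / subst1 x D'"
  have "f * g = (lin A B * lin A' B') / lin (D * D') 0"
    by (simp add: *(2,4) flip: subst1_lin)
  then show "f * g \<in> K"
    using *(1,3) ff_carrierI[of "D * D'" 0] by (simp add: lin_mult lin_add)
qed

lemma inverse_in_K [simp]:
  assumes "f \<in> K"
  shows "inverse f \<in> K"
proof (cases "f = 0")
  case False
  obtain A B D where *: "D \<noteq> 0" "f = lin A B / subst1 x D"
    using assms ff_carrierE by blast
  then have "inverse f = lin D 0 / lin A B"
    by (simp add: subst1_lin)
  then show ?thesis
    using ff_carrierI[of A B D 0] * False by auto
qed simp

lemma divide_in_K [simp]: "f \<in> K \<Longrightarrow> g \<in> K \<Longrightarrow> f / g \<in> K"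
  by (simp add: divide_inverse)

lemma minus_in_K [simp]: "f \<in> K \<Longrightarrow> - f \<in> K"
  using mult_in_K[OF emb_in_K[of "- 1"], of f] by simp

lemma diff_in_K [simp]: "f \<in> K \<Longrightarrow> g \<in> K \<Longrightarrow> f - g \<in> K"
  using add_in_K[of f "- g"] by simp

lemma power_in_K [simp]: "f \<in> K \<Longrightarrow> f ^ n \<in> K"
  by (induction n) auto

lemma powi_in_K [simp]: "f \<in> K \<Longrightarrow> f powi n \<in> K"
  by (simp add: power_int_def)

lemma subst1_K [simp]: "u \<in> K \<Longrightarrow> subst1 u A \<in> K"
  by (induction A) auto

lemma subst2_K [simp]: "u \<in> K \<Longrightarrow> v \<in> K \<Longrightarrow> subst2 (emb F) P u v \<in> K"
  by (induction P) auto

lemma has_value_in_K: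
  assumes "has_value F f \<alpha> c"
  shows "f \<in> K"
  using assms by (cases \<alpha>) (auto simp: has_value_in_chart_def)

text \<open>
  \<open>small m g\<close> says that the pole order of \<open>g\<close> at infinity is below \<open>m\<close>, where \<open>x\<close> and \<open>y\<close> have
  pole orders 2 and 3. As \<open>y ^ k\<close> is not \<open>small (3 * k)\<close>, the relation \<open>near_at k w c\<close> below
  determines the value \<open>c\<close> of \<open>w\<close> at infinity.
\<close>

definition small :: "nat \<Rightarrow> 'k \<Rightarrow> bool"
  where "small m g \<longleftrightarrow> (\<exists>A B. g = lin A B \<and> (A = 0 \<or> 2 * degree A < m) \<and>
    (B = 0 \<or> 2 * degree B + 3 < m))"

lemma small_iff: "small m (lin A B) \<longleftrightarrow>
   (A = 0 \<or> 2 * degree A < m) \<and> (B = 0 \<or> 2 * degree B + 3 < m)"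
  unfolding small_def lin_inject by blast

lemma smallE:
  assumes "small m g"
  obtains A B where "g = lin A B" "A = 0 \<or> 2 * degree A < m" "B = 0 \<or> 2 * degree B + 3 < m"
  using assms small_def by blast

lemma small_norm: "A \<noteq> 0 \<or> B \<noteq> 0 \<Longrightarrow> small m (lin A B) \<longleftrightarrow> degree (nrm A B) < m"
  unfolding small_iff by (auto simp: degree_norm)

lemma small_mono: "small m g \<Longrightarrow> m \<le> n \<Longrightarrow> small n g"
  unfolding small_def by fastforce

lemma small_add:
  assumes "small m f" "small m g"
  shows "small m (f + g)"
proof -
  obtain A B where A: "f = lin A B" "A = 0 \<or> 2 * degree A < m" "B = 0 \<or> 2 * degree B + 3 < m"
    using assms smallE by blast
  obtain C D where C: "g = lin C D" "C = 0 \<or> 2 * degree C < m" "D = 0 \<or> 2 * degree D + 3 < m"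
    using assms smallE by blast
  have "A + C = 0 \<or> 2 * degree (A + C) < m" "B + D = 0 \<or> 2 * degree (B + D) + 3 < m"
    using A C degree_add_le_max[of A C] degree_add_le_max[of B D] by fastforce+
  then show ?thesis
    unfolding A(1) C(1) lin_add small_iff by blast
qed

text \<open>Pole orders add because they are degrees of norms and the norm is
  multiplicative.\<close>

lemma small_lin_mult:
  assumes "small m g" "A \<noteq> 0 \<or> B \<noteq> 0"
  shows "small (m + degree (nrm A B)) (lin A B * g)"
proof (cases "g = 0")
  case True
  then show ?thesis
    using small_iff[of _ 0 0] by (simp add: lin_def)
next
  case False
  obtain C D where g: "g = lin C D"
    using assms small_def by blast
  then have CD: "C \<noteq> 0 \<or> D \<noteq> 0"
    using False by auto
  then have "degree (nrm C D) < m"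
    using assms g small_norm by blast
  moreover have "lin A B * g \<noteq> 0"
    using assms False by simp
  then have "A * C + B * D * cubic \<noteq> 0 \<or> A * D + B * C - B * D * h \<noteq> 0"
    using lin_mult g lin_eq_0_iff by metis
  ultimately show ?thesis
    unfolding g lin_mult small_norm norm_mult
    using norm_nonzero CD assms(2) by (subst small_norm) (auto simp: norm_mult degree_mult_eq)
qed

lemma y_power:
  obtains A B where "y ^ k = lin A B" "nrm A B = (- cubic) ^ k"
proof -
  have "\<exists>A B. y ^ k = lin A B \<and> nrm A B = (- cubic) ^ k"
  proof (induction k)
    case 0
    have "y ^ 0 = lin 1 0 \<and> nrm 1 0 = (- cubic) ^ 0"
      by (simp add: lin_def nrm_def)
    then show ?case by blast
  next
    case (Suc k)
    then obtain A B where "y ^ k = lin A B" "nrm A B = (- cubic) ^ k"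
      by blast
    moreover have "nrm 0 1 = - cubic"
      by (simp add: nrm_def)
    ultimately show ?case
      using lin_mult[of 0 1 A B] norm_mult[of 0 A 1 B] by (metis power_Suc y_lin)
  qed
  then show ?thesis
    using that by blast
qed

lemma degree_cubic_power [simp]: "degree ((- cubic) ^ k) = 3 * k"
  by (simp add: degree_power_eq)

lemma small_y_power: "small (3 * k + 1) (y ^ k)"
proof -
  obtain A B where "y ^ k = lin A B" "nrm A B = (- cubic) ^ k"
    using y_power by blast
  moreover from this have "A \<noteq> 0 \<or> B \<noteq> 0"
    by (metis cubic_nonzero neg_equal_0_iff_equal norm_eq_0_iff power_not_zero)
  ultimately show ?thesis
    by (simp add: small_norm)
qed

lemma small_x: "small m g \<Longrightarrow> small (m + 2) (x * g)"
  using small_lin_mult[of m g "[:0, 1:]" 0] by (simp add: nrm_def flip: x_lin)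

lemma small_y: "small m g \<Longrightarrow> small (m + 3) (y * g)"
  using small_lin_mult[of m g 0 1] by (simp add: nrm_def flip: y_lin)

lemma small_emb: "small m g \<Longrightarrow> small m (emb F c * g)"
  using small_lin_mult[of m g "[:c:]" 0] small_iff[of m 0 0]
  by (cases "c = 0") (auto simp: nrm_def lin_def)

lemma not_small_y_power:
  assumes "small (3 * k) (emb F c * y ^ k)"
  shows "c = 0"
proof (rule ccontr)
  assume "c \<noteq> 0"
  have "small (3 * k) (emb F (inverse c) * (emb F c * y ^ k))"
    by (rule small_emb[OF assms])
  then have *: "small (3 * k) (y ^ k)"
    using \<open>c \<noteq> 0\<close> by (simp flip: mult.assoc)
  obtain A B where "y ^ k = lin A B" "nrm A B = (- cubic) ^ k"
    using y_power by blast
  moreover from this have "A \<noteq> 0 \<or> B \<noteq> 0"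
    by (metis cubic_nonzero neg_equal_0_iff_equal norm_eq_0_iff power_not_zero)
  ultimately show False
    using * by (simp add: small_norm)
qed

definition near_at :: "nat \<Rightarrow> 'k \<Rightarrow> 'c \<Rightarrow> bool"
  where "near_at k w c \<longleftrightarrow> small (3 * k) (y ^ k * w - emb F c * y ^ k)"

lemma near_at_Suc: "near_at k w c \<Longrightarrow> near_at (Suc k) w c"
  unfolding near_at_def using small_y[of "3 * k" "y ^ k * w - emb F c * y ^ k"]
  by (simp add: algebra_simps)

lemma near_at_mono: "k \<le> l \<Longrightarrow> near_at k w c \<Longrightarrow> near_at l w c"
  by (induction l rule: dec_induct) (auto intro: near_at_Suc)

lemma near_at_add:
  assumes "near_at k w c" "near_at l z d"
  shows "near_at (max k l) (w + z) (c + d)"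
proof -
  have "near_at (max k l) w c" "near_at (max k l) z d"
    using assms near_at_mono by (meson max.cobounded1 max.cobounded2)+
  from small_add[OF this[unfolded near_at_def]] show ?thesis
    unfolding near_at_def by (simp add: algebra_simps)
qed

lemma near_at_small:
  assumes "near_at k w c"
  shows "small (3 * k + 1) (y ^ k * w)"
proof -
  have "small (3 * k + 1) (y ^ k * w - emb F c * y ^ k)"
    using assms near_at_def small_mono by (meson le_add1)
  from small_add[OF this small_emb[OF small_y_power, where c = c]] show ?thesis
    by simp
qed

lemma near_at_x: "near_at k w c \<Longrightarrow> near_at (Suc k) (x / y * w) 0"
  unfolding near_at_def[of "Suc k"] using small_x[OF near_at_small[of k w c]]
  by (simp add: algebra_simps numeral_3_eq_3)

lemma near_at_y: "near_at k w c \<Longrightarrow> near_at (Suc k) (1 / y * w) 0"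
  unfolding near_at_def[of "Suc k"] using small_mono[OF near_at_small[of k w c]]
  by (simp add: algebra_simps)

lemma near_at_emb: "near_at 0 (emb F c) c"
  using small_iff[of 0 0 0] by (simp add: near_at_def lin_def)

lemma near_at_subst1: "\<exists>k. near_at k (subst1 (x / y) A) (poly A 0)"
proof (induction A)
  case 0
  then show ?case
    using near_at_emb[of 0] by auto
next
  case (pCons a A)
  then obtain k where "near_at k (subst1 (x / y) A) (poly A 0)"
    by blast
  from near_at_add[OF near_at_emb near_at_x[OF this]] show ?case
    by fastforce
qed

text \<open>A high power of y clears all denominators, so that pole orders in the coordinate ring
  can be compared. Multiplication by x / y or 1 / y gives the value 0 since x and 1 have smaller
  pole order than y.\<close>

lemma near_at_subst2: "\<exists>k. near_at k (subst2 (emb F) P (x / y) (1 / y)) (eval2 P 0 0)"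
proof (induction P)
  case 0
  then show ?case
    using near_at_emb[of 0] by auto
next
  case (pCons A P)
  then obtain k l where "near_at k (subst2 (emb F) P (x / y) (1 / y)) (eval2 P 0 0)"
    "near_at l (subst1 (x / y) A) (poly A 0)"
    using near_at_subst1 by blast
  from near_at_add[OF this(2) near_at_y[OF this(1)]] show ?case
    by fastforce
qed

text \<open>If the expression vanishes, its formal value c at (0, 0) satisfies
  \<open>near_at k 0 c\<close>. So c y^k has pole order below 3 k, which forces c = 0.\<close>

sublocale infinity: chart F "x / y" "1 / y" 0 0
proof
  fix P
  assume "subst2 (emb F) P (x / y) (1 / y) = 0"
  then obtain k where "near_at k 0 (eval2 P 0 0)"
    using near_at_subst2[of P] by auto
  then have "small (3 * k) (emb F (- 1) * (0 - emb F (eval2 P 0 0) * y ^ k))"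
    unfolding near_at_def by (intro small_emb) simp
  then show "eval2 P 0 0 = 0"
    using not_small_y_power by simp
qed

lemma affine_in_curve: "Affine u v \<in> curve_points E \<longleftrightarrow> v * v + poly h u * v = poly cubic u"
  by (auto simp: curve_points_def weierstrass_poly_eq algebra_simps)

lemma affine_chart:
  assumes "Affine u v \<in> curve_points E"
  shows "chart F x y u v"
proof
  fix P
  assume "subst2 (emb F) P x y = 0"
  then obtain Q where "P = weierstrass_poly E * Q"
    by (auto simp: subst2_eq_0_iff)
  moreover have "eval2 (weierstrass_poly E) u v = 0"
    using assms by (auto simp: curve_points_def)
  ultimately show "eval2 P u v = 0"
    by simp
qed

end

section \<open>Valuations at the points of the curve\<close>

fun curve_neg :: "'c::field weierstrass \<Rightarrow> 'c point \<Rightarrow> 'c point"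
  where
    "curve_neg E Infinity = Infinity"
  | "curve_neg E (Affine u v) = Affine u (- v - A1 E * u - A3 E)"

lemma split_root:
  fixes p :: "'c::field poly"
  assumes "poly p u = 0"
  obtains q where "p = [:- u, 1:] * q"
  using assms by (auto simp: poly_eq_0_iff_dvd)

lemma split_order:
  fixes p :: "'c::field poly"
  assumes "p \<noteq> 0"
  obtains q where "p = [:- u, 1:] ^ Polynomial.order u p * q" "poly q u \<noteq> 0"
  using order_decomp[OF assms, of u] by (auto simp: poly_eq_0_iff_dvd)

text \<open>Splits off the common power of x - u, so that orders of \<open>lin A B\<close> at a
  point over u have to be found only for primitive pairs, whose coefficients do not both vanish at
  u.\<close>

lemma common_root_split:
  fixes A B :: "'c::field poly"
  assumes "A \<noteq> 0 \<or> B \<noteq> 0"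
  obtains k A' B' where "A = [:- u, 1:] ^ k * A'" "B = [:- u, 1:] ^ k * B'"
    "poly A' u \<noteq> 0 \<or> poly B' u \<noteq> 0"
proof -
  have "\<exists>k A' B'. A = [:- u, 1:] ^ k * A' \<and> B = [:- u, 1:] ^ k * B' \<and>
    (poly A' u \<noteq> 0 \<or> poly B' u \<noteq> 0)"
    using assms
  proof (induction "degree A + degree B" arbitrary: A B rule: less_induct)
    case less
    show ?case
    proof (cases "poly A u = 0 \<and> poly B u = 0")
      case True
      then obtain C D where CD: "A = [:- u, 1:] * C" "B = [:- u, 1:] * D"
        using split_root by metis
      have deg: "degree ([:- u, 1:] * p) = degree p + 1" if "p \<noteq> 0" for p
        using that degree_mult_eq[of "[:- u, 1:]" p] by simp
      have nz: "C \<noteq> 0 \<or> D \<noteq> 0"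
        using less.prems CD by auto
      then have "degree C + degree D < degree A + degree B"
        unfolding CD using deg[of C] deg[of D] by (cases "C = 0"; cases "D = 0") simp_all
      from less.hyps[OF this nz] obtain k A' B' where "C = [:- u, 1:] ^ k * A'"
        "D = [:- u, 1:] ^ k * B'" "poly A' u \<noteq> 0 \<or> poly B' u \<noteq> 0"
        by blast
      then show ?thesis
        unfolding CD by (intro exI[of _ "Suc k"] exI[of _ A'] exI[of _ B'])
          (simp add: mult.assoc del: mult_pCons_left)
    next
      case False
      then show ?thesis
        by (intro exI[of _ 0] exI[of _ A] exI[of _ B]) auto
    qed
  qed
  then show ?thesis
    using that by blast
qed

context elliptic_function_field
begin

declare has_value.simps [simp del]

text \<open>The expression is the y-derivative of the Weierstrass polynomial. On the curve its zeros
  are the affine points fixed by \<open>curve_neg\<close>, where x - u has order 2.\<close>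

abbreviation ramified :: "'c \<Rightarrow> 'c \<Rightarrow> bool"
  where "ramified u v \<equiv> v + v + poly h u = 0"

abbreviation conj1 :: "'c poly \<Rightarrow> 'c poly \<Rightarrow> 'c poly" where "conj1 A B \<equiv> A - h * B"

lemma poly_h: "poly h u = A3 E + A1 E * u"
  by (simp add: h_def)

lemma curve_neg_affine: "curve_neg E (Affine u v) = Affine u (- v - poly h u)"
  by (simp add: poly_h algebra_simps)

lemma curve_neg_closed: "P \<in> curve_points E \<Longrightarrow> curve_neg E P \<in> curve_points E"
proof (cases P)
  case (Affine u v)
  moreover assume "P \<in> curve_points E"
  ultimately show ?thesis
    by (simp add: affine_in_curve curve_neg_affine algebra_simps del: curve_neg.simps)
qed simp

lemma subst1_linear: "subst1 x [:- u, 1:] = x - emb F u"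
  by simp

lemma xu_nonzero: "x - emb F u \<noteq> 0" and yv_nonzero: "y - emb F v \<noteq> 0"
proof -
  have "x - emb F u = lin [:- u, 1:] 0" "y - emb F v = lin [:- v:] 1"
    by (simp_all add: lin_def)
  then show "x - emb F u \<noteq> 0" "y - emb F v \<noteq> 0"
    by simp_all
qed

lemma lin_scale: "lin (C * A) (C * B) = subst1 x C * lin A B"
  by (simp add: lin_def algebra_simps)

section \<open>Local parameters at affine points\<close>

lemma affine_place:
  assumes "Affine u v \<in> curve_points E" "has_value F t (Affine u v) 0" "t \<noteq> 0"
  shows "place (emb F) (\<lambda>f. has_value F f (Affine u v)) t"
proof -
  interpret chart F x y u v
    by (rule affine_chart) fact
  show ?thesis
    by unfold_locales (use assms hv_unique hv_add hv_mult hv_inverse hv_emb in \<open>auto simp: has_value.simps\<close>)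
qed

lemma has_value_lin:
  assumes "Affine u v \<in> curve_points E"
  shows "has_value F (lin A B) (Affine u v) (poly A u + poly B u * v)"
proof -
  interpret chart F x y u v
    by (rule affine_chart) fact
  show ?thesis
    using hv_subst2[of "[:A, B:]"] by (simp add: lin_def mult.commute has_value.simps)
qed

lemma has_value_subst1:
  assumes "Affine u v \<in> curve_points E"
  shows "has_value F (subst1 x A) (Affine u v) (poly A u)"
  using has_value_lin[OF assms, of A 0] by (simp add: lin_def)

lemma affine_place_xu:
  assumes "Affine u v \<in> curve_points E"
  shows "place (emb F) (\<lambda>f. has_value F f (Affine u v)) (x - emb F u)"
  using assms has_value_subst1[OF assms, of "[:- u, 1:]"] xu_nonzero
  by (intro affine_place) auto

lemma affine_place_yv:
  assumes "Affine u v \<in> curve_points E"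
  shows "place (emb F) (\<lambda>f. has_value F f (Affine u v)) (y - emb F v)"
  using assms has_value_lin[OF assms, of "[:- v:]" 1] yv_nonzero
  by (intro affine_place) (auto simp: lin_def)

text \<open>
  If the coefficients of \<open>lin A B\<close> do not both vanish at \<open>u\<close>, then \<open>lin A B\<close> and its conjugate do
  not both vanish at an unramified point, so there the order of \<open>lin A B\<close> is that of its norm.
\<close>

lemma unramified_primitive:
  assumes P: "Affine u v \<in> curve_points E" and unram: "\<not> ramified u v"
    and prim: "poly A u \<noteq> 0 \<or> poly B u \<noteq> 0" and zero: "poly A u + poly B u * v = 0"
  shows "place.has_ord (\<lambda>f. has_value F f (Affine u v)) (x - emb F u)
    (lin A B) (Polynomial.order u (nrm A B))"
proof -
  interpret place "emb F" "\<lambda>f. has_value F f (Affine u v)" "x - emb F u"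
    using P by (rule affine_place_xu)
  let ?d = "poly (conj1 A B) u + poly (- B) u * v"
  have "?d = - poly B u * (v + v + poly h u)"
    using zero by (simp add: algebra_simps)
  moreover have "poly B u \<noteq> 0"
    using prim zero by auto
  ultimately have "?d \<noteq> 0"
    using unram by simp
  then have conj: "has_ord (lin (conj1 A B) (- B)) 0"
    using has_ord_unit has_value_lin[OF P] by blast
  have "nrm A B \<noteq> 0"
    using prim by auto
  then obtain q where q: "nrm A B = [:- u, 1:] ^ Polynomial.order u (nrm A B) * q" "poly q u \<noteq> 0"
    using split_order by blast
  have "has_ord (subst1 x q) 0"
    using has_ord_unit has_value_subst1[OF P] q(2) by blast
  then have "has_ord ((x - emb F u) ^ Polynomial.order u (nrm A B) * subst1 x q) (Polynomial.order u (nrm A B))"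
    using has_ord_mult[OF has_ord_power[OF has_ord_t]] by fastforce
  moreover have "(x - emb F u) ^ Polynomial.order u (nrm A B) * subst1 x q = subst1 x (nrm A B)"
    by (subst q(1)) (simp only: subst1_mult subst1_power subst1_linear)
  ultimately have "has_ord (subst1 x (nrm A B)) (Polynomial.order u (nrm A B))"
    by simp
  from has_ord_divide[OF this conj] show ?thesis
    unfolding lin_conj[symmetric] using has_ord_nonzero[OF conj]
    by (auto split: if_splits)
qed

text \<open>Here the y-derivative vanishes, so the x-derivative cannot.\<close>

lemma nonsingular:
  assumes "Affine u v \<in> curve_points E" "ramified u v"
  shows "poly (pderiv cubic) u \<noteq> poly (pderiv h) u * v"
proof -
  have "eval2 (weierstrass_poly E) u v = 0"
    using assms by (auto simp: curve_points_def)
  then have "eval2 (map_poly pderiv (weierstrass_poly E)) u v \<noteq> 0 \<or>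
       eval2 (pderiv (weierstrass_poly E)) u v \<noteq> 0"
    using elliptic by (simp add: elliptic_curve_def)
  moreover have "eval2 (pderiv (weierstrass_poly E)) u v = 0"
    using assms(2) by (simp add: weierstrass_poly_eq pderiv_pCons algebra_simps)
  moreover have "eval2 (map_poly pderiv (weierstrass_poly E)) u v
      = - poly (pderiv cubic) u + poly (pderiv h) u * v"
    by (simp add: weierstrass_poly_eq map_poly_pCons pderiv_minus map_poly_1 pderiv_1)
  ultimately show ?thesis
    by auto
qed

text \<open>The curve equation expanded around (u, v) exhibits (y - v)^2 as x - u times a function
  whose value is, up to sign, the x-derivative of the Weierstrass polynomial, hence a unit.\<close>

lemma ramified_linear:
  assumes P: "Affine u v \<in> curve_points E" and ram: "ramified u v"
  obtains w c where "has_value F w (Affine u v) c" "c \<noteq> 0"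
    "(x - emb F u) * w = (y - emb F v) * (y - emb F v)"
proof -
  interpret place "emb F" "\<lambda>f. has_value F f (Affine u v)" "y - emb F v"
    using P by (rule affine_place_yv)
  define p where "p = cubic - smult v h - [:v * v:]"
  have "poly p u = 0"
    using P unfolding p_def affine_in_curve by (simp add: algebra_simps)
  then obtain q where q: "p = [:- u, 1:] * q"
    using split_root by blast
  have "poly (pderiv p) u = poly q u"
    unfolding q pderiv_mult by (simp add: pderiv_pCons)
  then have q0: "poly q u \<noteq> 0"
    using nonsingular[OF P ram] by (auto simp: p_def pderiv_diff pderiv_smult pderiv_pCons)
  \<comment> \<open>The curve equation gives (x - u) q = (y - v)(y + v + h). As h(u) = -2v, the last
    factor is (y - v) + A1 (x - u); moving its second term to the left leaves this w.\<close>
  let ?w = "subst1 x q + emb F (- A1 E) * (y - emb F v)"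
  have "has_value F ?w (Affine u v) (poly q u + (- A1 E) * 0)"
    by (intro hv_add hv_mult hv_t hv_const has_value_subst1 P)
  moreover have "(x - emb F u) * ?w = (y - emb F v) * (y - emb F v)"
  proof -
    have "(x - emb F u) * subst1 x q = subst1 x p"
      by (simp only: q subst1_mult subst1_linear)
    also have "\<dots> = subst1 x cubic - emb F v * subst1 x h - emb F v * emb F v"
      by (simp add: p_def)
    also have "\<dots> = (y - emb F v) * (y + emb F v + subst1 x h)"
      using curve_equation by (simp add: algebra_simps)
    finally have 1: "(x - emb F u) * subst1 x q = (y - emb F v) * (y + emb F v + subst1 x h)" .
    have "subst1 x h = emb F (A1 E) * (x - emb F u) + emb F (poly h u)"
      by (simp add: h_def algebra_simps)
    moreover have "emb F (poly h u) = - emb F v - emb F v"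
      using ram by (metis add_eq_0_iff hom_diff hom_minus minus_add_distrib uminus_add_conv_diff add.commute)
    ultimately have 2: "y + emb F v + subst1 x h = (y - emb F v) + emb F (A1 E) * (x - emb F u)"
      by simp
    show ?thesis
      unfolding distrib_left 1 2 by (simp add: algebra_simps)
  qed
  ultimately show ?thesis
    using that[of ?w "poly q u"] q0 by simp
qed

lemma ramified_xu:
  assumes P: "Affine u v \<in> curve_points E" and ram: "ramified u v"
  shows "place.has_ord (\<lambda>f. has_value F f (Affine u v)) (y - emb F v) (x - emb F u) 2"
proof -
  interpret place "emb F" "\<lambda>f. has_value F f (Affine u v)" "y - emb F v"
    using P by (rule affine_place_yv)
  obtain w c where w: "has_value F w (Affine u v) c" "c \<noteq> 0"
    "(x - emb F u) * w = (y - emb F v) * (y - emb F v)"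
    using ramified_linear[OF assms] .
  have "has_ord ((x - emb F u) * w) 2"
    unfolding w(3) using has_ord_mult[OF has_ord_t has_ord_t] by simp
  from has_ord_divide[OF this has_ord_unit[OF w(1,2)]] show ?thesis
    using hv_nonzero[OF w(1,2)] by simp
qed

text \<open>In A + B y = (A + v B) + (y - v) B the first summand is divisible by x - u, hence by (y
  - v)^2 up to a unit. So y - v factors out and leaves a function with value B(u), which is
  nonzero.\<close>

lemma ramified_primitive:
  assumes P: "Affine u v \<in> curve_points E" and ram: "ramified u v"
    and prim: "poly A u \<noteq> 0 \<or> poly B u \<noteq> 0" and zero: "poly A u + poly B u * v = 0"
  shows "place.has_ord (\<lambda>f. has_value F f (Affine u v)) (y - emb F v) (lin A B) 1"
proof -
  interpret place "emb F" "\<lambda>f. has_value F f (Affine u v)" "y - emb F v"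
    using P by (rule affine_place_yv)
  obtain w c where w: "has_value F w (Affine u v) c" "c \<noteq> 0"
    "(x - emb F u) * w = (y - emb F v) * (y - emb F v)"
    using ramified_linear[OF P ram] .
  then have w0: "w \<noteq> 0"
    using hv_nonzero by blast
  have "poly (A + smult v B) u = 0"
    using zero by (simp add: mult.commute)
  then obtain r where r: "A + smult v B = [:- u, 1:] * r"
    using split_root by blast
  let ?z = "subst1 x B + (y - emb F v) * (subst1 x r * inverse w)"
  have "has_value F ?z (Affine u v) (poly B u + 0 * (poly r u * inverse c))"
    by (intro hv_add hv_mult hv_t hv_inverse w has_value_subst1 P)
  moreover have "poly B u \<noteq> 0"
    using prim zero by auto
  ultimately have "has_ord ?z 0"
    using has_ord_unit by simp
  from has_ord_mult[OF has_ord_t this] have "has_ord ((y - emb F v) * ?z) 1"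
    by simp
  moreover have "(y - emb F v) * ?z = lin A B"
  proof -
    have "lin A B = subst1 x (A + smult v B) + (y - emb F v) * subst1 x B"
      by (simp add: lin_def algebra_simps)
    also have "subst1 x (A + smult v B) = (x - emb F u) * subst1 x r"
      by (simp only: r subst1_mult subst1_linear)
    also have "x - emb F u = (y - emb F v) * (y - emb F v) * inverse w"
      using w(3) w0 by (simp add: field_simps)
    finally show ?thesis
      by (simp add: algebra_simps)
  qed
  ultimately show ?thesis
    by simp
qed

lemma curve_placeI:
  assumes "place (emb F) (\<lambda>f. has_value F f \<alpha>) t"
    and lin: "\<And>A B. A \<noteq> 0 \<or> B \<noteq> 0 \<Longrightarrow> \<exists>n. place.has_ord (\<lambda>f. has_value F f \<alpha>) t (lin A B) n"
  shows "curve_place F \<alpha> t"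
proof -
  interpret place "emb F" "\<lambda>f. has_value F f \<alpha>" t
    by fact
  show ?thesis
  proof
    fix f
    assume f: "f \<in> K" "f \<noteq> 0"
    then obtain A B D where ABD: "D \<noteq> 0" "f = lin A B / subst1 x D"
      using ff_carrierE by metis
    then have "A \<noteq> 0 \<or> B \<noteq> 0"
      using f(2) by auto
    then show "\<exists>n. has_ord f n"
      using lin[of A B] lin[of D 0] ABD has_ord_divide unfolding subst1_lin by blast
  qed (rule has_value_in_K)
qed

lemma affine_curve_place:
  assumes P: "Affine u v \<in> curve_points E"
    and t: "t = (if ramified u v then y - emb F v else x - emb F u)"
  shows "curve_place F (Affine u v) t"
proof -
  interpret place "emb F" "\<lambda>f. has_value F f (Affine u v)" t
    using affine_place_xu[OF P] affine_place_yv[OF P] t by simp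
  show ?thesis
  proof (rule curve_placeI)
    fix A B :: "'c poly"
    assume "A \<noteq> 0 \<or> B \<noteq> 0"
    then obtain k A' B' where *: "A = [:- u, 1:] ^ k * A'" "B = [:- u, 1:] ^ k * B'"
      and prim: "poly A' u \<noteq> 0 \<or> poly B' u \<noteq> 0"
      by (rule common_root_split)
    have "\<exists>n. has_ord (lin A' B') n"
    proof (cases "poly A' u + poly B' u * v = 0")
      case True
      then show ?thesis
        using unramified_primitive[OF P _ prim] ramified_primitive[OF P _ prim] t by auto
    next
      case False
      then show ?thesis
        using has_value_lin[OF P] has_ord_unit by blast
    qed
    moreover have "\<exists>n. has_ord (x - emb F u) n"
      using ramified_xu[OF P] has_ord_t t by auto
    moreover have "lin A B = (x - emb F u) ^ k * lin A' B'"
      unfolding * lin_scale by (simp only: subst1_power subst1_linear)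
    ultimately show "\<exists>n. has_ord (lin A B) n"
      using has_ord_mult has_ord_power by metis
  qed (fact place_axioms)
qed

section \<open>The place at infinity\<close>

lemma x_nonzero [simp]: "x \<noteq> 0"
  by (simp add: x_lin)

sublocale at_infinity: place "emb F" "\<lambda>f. has_value F f Infinity" "x / y"
proof
  have "has_value_in_chart F (x / y) (1 / y) 0 0 (subst2 (emb F) [:[:0, 1:]:] (x / y) (1 / y)) 0"
    using infinity.hv_subst2[of "[:[:0, 1:]:]"] by simp
  then show "has_value F (x / y) Infinity 0"
    by (simp add: has_value.simps)
  show "x / y \<noteq> 0"
    by simp
qed (use infinity.hv_unique infinity.hv_add infinity.hv_mult infinity.hv_inverse infinity.hv_emb
  in \<open>auto simp: has_value.simps\<close>)

lemma infinity_has_ord_y: "at_infinity.has_ord y (- 3)"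
proof -
  \<comment> \<open>The Weierstrass equation solved for x^3 and divided by y^2, written in x / y and
    1 / y. Hence x^3 = y^2 w with w of value 1, that is, 1 / y = (x / y)^3 / w.\<close>
  define w where "w = [:[:1, A1 E, - A2 E:], [:A3 E, - A4 E:], [:- A6 E:]:]"
  let ?w = "subst2 (emb F) w (x / y) (1 / y)"
  have "has_value F ?w Infinity 1"
    using infinity.hv_subst2[of w] by (simp add: w_def has_value.simps)
  then have w: "at_infinity.has_ord ?w 0"
    by (rule at_infinity.has_ord_unit) simp
  have "y * y + subst1 x h * y = subst1 x cubic"
    using curve_equation by simp
  then have "y * y * ?w = x * x * x"
    unfolding w_def h_def cubic_def by (simp add: field_simps) algebra
  then have "inverse y = (x / y) ^ 3 / ?w"
    using at_infinity.has_ord_nonzero[OF w] by (simp add: field_simps power3_eq_cube)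
  moreover have "at_infinity.has_ord ((x / y) ^ 3 / ?w) 3"
    using at_infinity.has_ord_divide[OF at_infinity.has_ord_power[OF at_infinity.has_ord_t] w, of 3]
    by simp
  ultimately have "at_infinity.has_ord (inverse y) 3"
    by (simp only:)
  then show ?thesis
    using at_infinity.has_ord_inverse[of "inverse y" 3] by (simp only: inverse_inverse_eq)
qed

lemma infinity_has_ord_x: "at_infinity.has_ord x (- 2)"
  using at_infinity.has_ord_mult[OF at_infinity.has_ord_t infinity_has_ord_y] by simp

lemma infinity_has_ord_emb: "c \<noteq> 0 \<Longrightarrow> at_infinity.has_ord (emb F c) 0"
  using at_infinity.has_ord_unit at_infinity.hv_const by blast

lemma infinity_has_ord_subst1: "A \<noteq> 0 \<Longrightarrow> at_infinity.has_ord (subst1 x A) (- (2 * degree A))"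
proof (induction A)
  case (pCons a A)
  show ?case
  proof (cases "A = 0")
    case True
    then show ?thesis
      using infinity_has_ord_emb[of a] pCons by simp
  next
    case False
    then have *: "at_infinity.has_ord (x * subst1 x A) (- 2 - 2 * degree A)"
      using at_infinity.has_ord_mult[OF infinity_has_ord_x pCons.IH] by simp
    show ?thesis
    proof (cases "a = 0")
      case True
      then show ?thesis using * False by simp
    next
      case a: False
      show ?thesis
        using at_infinity.has_ord_add[OF * infinity_has_ord_emb[OF a]] False
        by (simp add: add.commute)
    qed
  qed
qed simp

text \<open>The two summands have orders of different parity, so the smaller one is the order of the
  sum.\<close>

lemma infinity_has_ord_lin:
  assumes "A \<noteq> 0 \<or> B \<noteq> 0"
  shows "at_infinity.has_ord (lin A B) (- degree (nrm A B))"
proof -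
  have A: "at_infinity.has_ord (subst1 x A) (- (2 * degree A))" if "A \<noteq> 0"
    using that by (rule infinity_has_ord_subst1)
  have B: "at_infinity.has_ord (subst1 x B * y) (- (2 * degree B + 3))" if "B \<noteq> 0"
    using at_infinity.has_ord_mult[OF infinity_has_ord_subst1[OF that] infinity_has_ord_y] by simp
  consider "B = 0" | "A = 0" "B \<noteq> 0" | "A \<noteq> 0" "B \<noteq> 0" "2 * degree A < 2 * degree B + 3"
    | "A \<noteq> 0" "B \<noteq> 0" "2 * degree A > 2 * degree B + 3"
  proof -
    have "2 * degree A \<noteq> 2 * degree B + 3"
      by presburger
    then show ?thesis
      using that by linarith
  qed
  then show ?thesis
  proof cases
    case 1
    then show ?thesis
      using A assms by (simp add: lin_def degree_norm)
  next
    case 2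
    then show ?thesis
      using B by (simp add: lin_def degree_norm)
  next
    case 3
    then show ?thesis
      using at_infinity.has_ord_add[OF B A] by (simp add: lin_def degree_norm max_def add.commute)
  next
    case 4
    then show ?thesis
      using at_infinity.has_ord_add[OF A B] by (simp add: lin_def degree_norm max_def)
  qed
qed

lemma infinity_curve_place: "curve_place F Infinity (x / y)"
  using infinity_has_ord_lin by (intro curve_placeI at_infinity.place_axioms) blast

lemma curve_place_ex:
  assumes "\<alpha> \<in> curve_points E"
  shows "\<exists>t. curve_place F \<alpha> t"
  using assms infinity_curve_place affine_curve_place by (cases \<alpha>) blast+

section \<open>Arithmetic of valuations\<close>

abbreviation \<nu> :: "'c point \<Rightarrow> 'k \<Rightarrow> int" where "\<nu> \<equiv> valuation F"

context
  fixes \<alpha>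
  assumes \<alpha>: "\<alpha> \<in> curve_points E"
begin

lemma val_mult: "f \<in> K \<Longrightarrow> f \<noteq> 0 \<Longrightarrow> g \<in> K \<Longrightarrow> g \<noteq> 0 \<Longrightarrow> \<nu> \<alpha> (f * g) = \<nu> \<alpha> f + \<nu> \<alpha> g"
proof -
  obtain t where "curve_place F \<alpha> t" using curve_place_ex \<alpha> by blast
  then interpret curve_place F \<alpha> t .
  show "f \<in> K \<Longrightarrow> f \<noteq> 0 \<Longrightarrow> g \<in> K \<Longrightarrow> g \<noteq> 0 \<Longrightarrow> \<nu> \<alpha> (f * g) = \<nu> \<alpha> f + \<nu> \<alpha> g"
    using valuation_eq has_ord_mult has_ord_valuation by blast
qed

lemma val_inverse: "f \<in> K \<Longrightarrow> f \<noteq> 0 \<Longrightarrow> \<nu> \<alpha> (inverse f) = - \<nu> \<alpha> f"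
proof -
  obtain t where "curve_place F \<alpha> t" using curve_place_ex \<alpha> by blast
  then interpret curve_place F \<alpha> t .
  show "f \<in> K \<Longrightarrow> f \<noteq> 0 \<Longrightarrow> \<nu> \<alpha> (inverse f) = - \<nu> \<alpha> f"
    using valuation_eq has_ord_inverse has_ord_valuation by blast
qed

lemma val_divide:
  "f \<in> K \<Longrightarrow> f \<noteq> 0 \<Longrightarrow> g \<in> K \<Longrightarrow> g \<noteq> 0 \<Longrightarrow> \<nu> \<alpha> (f / g) = \<nu> \<alpha> f - \<nu> \<alpha> g"
  using val_mult[of f "inverse g"] val_inverse[of g] by (simp add: divide_inverse)

lemma val_pos_iff: "f \<in> K \<Longrightarrow> f \<noteq> 0 \<Longrightarrow> \<nu> \<alpha> f > 0 \<longleftrightarrow> has_value F f \<alpha> 0"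
proof -
  obtain t where "curve_place F \<alpha> t" using curve_place_ex \<alpha> by blast
  then interpret curve_place F \<alpha> t .
  show "f \<in> K \<Longrightarrow> f \<noteq> 0 \<Longrightarrow> \<nu> \<alpha> f > 0 \<longleftrightarrow> has_value F f \<alpha> 0"
    using has_ord_pos_hv hv_0_has_ord_pos has_ord_valuation by blast
qed

lemma val_nonneg_iff: "f \<in> K \<Longrightarrow> f \<noteq> 0 \<Longrightarrow> \<nu> \<alpha> f \<ge> 0 \<longleftrightarrow> (\<exists>c. has_value F f \<alpha> c)"
proof -
  obtain t where "curve_place F \<alpha> t" using curve_place_ex \<alpha> by blast
  then interpret curve_place F \<alpha> t .
  show "f \<in> K \<Longrightarrow> f \<noteq> 0 \<Longrightarrow> \<nu> \<alpha> f \<ge> 0 \<longleftrightarrow> (\<exists>c. has_value F f \<alpha> c)"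
    using has_ord_nonneg_hv hv_has_ord_nonneg has_ord_valuation by blast
qed

lemma val_unit: "has_value F f \<alpha> c \<Longrightarrow> c \<noteq> 0 \<Longrightarrow> \<nu> \<alpha> f = 0"
proof -
  obtain t where "curve_place F \<alpha> t" using curve_place_ex \<alpha> by blast
  then interpret curve_place F \<alpha> t .
  show "has_value F f \<alpha> c \<Longrightarrow> c \<noteq> 0 \<Longrightarrow> \<nu> \<alpha> f = 0"
    using has_ord_unit valuation_eq by blast
qed

lemma val_decompose:
  obtains t where "t \<in> K" "t \<noteq> 0" "\<nu> \<alpha> t = 1" "has_value F t \<alpha> 0"
    "\<And>f. f \<in> K \<Longrightarrow> f \<noteq> 0 \<Longrightarrow> \<exists>w c. has_value F w \<alpha> c \<and> c \<noteq> 0 \<and> f = w * t powi \<nu> \<alpha> f"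
proof -
  obtain t where "curve_place F \<alpha> t" using curve_place_ex \<alpha> by blast
  then interpret curve_place F \<alpha> t .
  show ?thesis
    using that[of t] hv_t t_nz has_value_in_K valuation_eq[OF has_ord_t]
      has_ord_valuation[unfolded has_ord_def] by blast
qed

lemma val_emb: "c \<noteq> 0 \<Longrightarrow> \<nu> \<alpha> (emb F c) = 0"
proof -
  obtain t where "curve_place F \<alpha> t" using curve_place_ex \<alpha> by blast
  then interpret curve_place F \<alpha> t .
  show "c \<noteq> 0 \<Longrightarrow> \<nu> \<alpha> (emb F c) = 0"
    using hv_const val_unit by blast
qed

lemma val_1 [simp]: "\<nu> \<alpha> 1 = 0"
  using val_emb[of 1] by simp

lemma val_power: "f \<in> K \<Longrightarrow> f \<noteq> 0 \<Longrightarrow> \<nu> \<alpha> (f ^ n) = n * \<nu> \<alpha> f"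
  by (induction n) (simp_all add: val_mult algebra_simps)

lemma val_powi: "f \<in> K \<Longrightarrow> f \<noteq> 0 \<Longrightarrow> \<nu> \<alpha> (f powi n) = n * \<nu> \<alpha> f"
  by (simp add: power_int_def val_power val_inverse)

end

lemma val_infinity_lin: "A \<noteq> 0 \<or> B \<noteq> 0 \<Longrightarrow> \<nu> Infinity (lin A B) = - degree (nrm A B)"
  using infinity_has_ord_lin curve_place.valuation_eq[OF infinity_curve_place] by blast

section \<open>Coordinate ring elements at affine points\<close>

context
  fixes u v
  assumes P: "Affine u v \<in> curve_points E"
begin

lemma val_lin_nonneg: "A \<noteq> 0 \<or> B \<noteq> 0 \<Longrightarrow> \<nu> (Affine u v) (lin A B) \<ge> 0"
  using val_nonneg_iff[OF P lin_in_K] has_value_lin[OF P] by (metis lin_eq_0_iff)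

lemma val_lin_pos_iff:
  assumes "A \<noteq> 0 \<or> B \<noteq> 0"
  shows "\<nu> (Affine u v) (lin A B) > 0 \<longleftrightarrow> poly A u + poly B u * v = 0"
proof (cases "poly A u + poly B u * v = 0")
  case True
  then have "has_value F (lin A B) (Affine u v) 0"
    using has_value_lin[OF P, of A B] by simp
  then show ?thesis
    using True val_pos_iff[OF P lin_in_K, of A B] assms by simp
next
  case False
  then show ?thesis
    using val_unit[OF P has_value_lin[OF P, of A B]] by simp
qed

lemma val_lin_zero_iff:
  assumes "A \<noteq> 0 \<or> B \<noteq> 0"
  shows "\<nu> (Affine u v) (lin A B) = 0 \<longleftrightarrow> poly A u + poly B u * v \<noteq> 0"
  using val_lin_pos_iff[OF assms] val_lin_nonneg[OF assms] by auto

lemma val_xu: "\<nu> (Affine u v) (x - emb F u) = (if ramified u v then 2 else 1)"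
proof (cases "ramified u v")
  case True
  then have "curve_place F (Affine u v) (y - emb F v)"
    using P by (intro affine_curve_place) auto
  from curve_place.valuation_eq[OF this ramified_xu[OF P True]] show ?thesis
    using True by simp
next
  case False
  with P have c: "curve_place F (Affine u v) (x - emb F u)"
    by (intro affine_curve_place) auto
  have "place.has_ord (\<lambda>f. has_value F f (Affine u v)) (x - emb F u) (x - emb F u) 1"
    by (rule place.has_ord_t[OF affine_place_xu[OF P]])
  from curve_place.valuation_eq[OF c this] show ?thesis
    using False by simp
qed

lemma val_unramified_primitive:
  assumes "\<not> ramified u v" "poly A u \<noteq> 0 \<or> poly B u \<noteq> 0" "poly A u + poly B u * v = 0"
  shows "\<nu> (Affine u v) (lin A B) = Polynomial.order u (nrm A B)"
proof -
  have "curve_place F (Affine u v) (x - emb F u)"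
    using P assms by (intro affine_curve_place) auto
  from curve_place.valuation_eq[OF this unramified_primitive[OF P assms]] show ?thesis .
qed

lemma val_ramified_primitive:
  assumes "ramified u v" "poly A u \<noteq> 0 \<or> poly B u \<noteq> 0" "poly A u + poly B u * v = 0"
  shows "\<nu> (Affine u v) (lin A B) = 1"
proof -
  have "curve_place F (Affine u v) (y - emb F v)"
    using P assms by (intro affine_curve_place) auto
  from curve_place.valuation_eq[OF this ramified_primitive[OF P assms]] show ?thesis .
qed

lemma val_subst1:
  assumes "D \<noteq> 0"
  shows "\<nu> (Affine u v) (subst1 x D) = Polynomial.order u D * (if ramified u v then 2 else 1)"
proof -
  obtain q where q: "D = [:- u, 1:] ^ Polynomial.order u D * q" "poly q u \<noteq> 0"
    using split_order[OF assms] .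
  have "q \<noteq> 0"
    using q(2) by auto
  have "subst1 x D = (x - emb F u) ^ Polynomial.order u D * subst1 x q"
    by (subst q(1)) (simp only: subst1_mult subst1_power subst1_linear)
  then show ?thesis
    using val_mult[OF P, of "(x - emb F u) ^ Polynomial.order u D" "subst1 x q"] xu_nonzero[of u] \<open>q \<noteq> 0\<close>
      val_power[OF P] val_xu val_unit[OF P has_value_subst1[OF P]] q(2)
    by simp
qed

end

text \<open>For a primitive pair the order is determined by the value at the point, by ramification
  and by the norm, and conjugation together with negation preserves all three. The common power of x
  - u has the same order at both points.\<close>

lemma val_conj:
  assumes P: "Affine u v \<in> curve_points E" and nz: "A \<noteq> 0 \<or> B \<noteq> 0"
  shows "\<nu> (Affine u (- v - poly h u)) (lin A B) = \<nu> (Affine u v) (lin (conj1 A B) (- B))"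
proof -
  let ?v = "- v - poly h u"
  have P': "Affine u ?v \<in> curve_points E"
    using curve_neg_closed[OF P] by (simp only: curve_neg_affine)
  have ram: "ramified u ?v \<longleftrightarrow> ramified u v"
  proof -
    have "?v + ?v + poly h u = - (v + v + poly h u)" by simp
    then show ?thesis by (metis neg_equal_0_iff_equal)
  qed
  have prim: "\<nu> (Affine u ?v) (lin A B) = \<nu> (Affine u v) (lin (conj1 A B) (- B))"
    if "poly A u \<noteq> 0 \<or> poly B u \<noteq> 0" for A B
  proof -
    have conj: "poly (conj1 A B) u + poly (- B) u * v = poly A u + poly B u * ?v"
      by (simp add: algebra_simps)
    have prim': "poly (conj1 A B) u \<noteq> 0 \<or> poly (- B) u \<noteq> 0"
      using that by auto
    show ?thesis
    proof (cases "poly A u + poly B u * ?v = 0")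
      case True
      then show ?thesis
        using val_ramified_primitive[OF P _ prim'] val_ramified_primitive[OF P' _ that]
          val_unramified_primitive[OF P _ prim'] val_unramified_primitive[OF P' _ that]
          ram conj norm_conj[of A B]
        by (cases "ramified u v") auto
    next
      case False
      then show ?thesis
        using val_unit[OF P has_value_lin[OF P]] val_unit[OF P' has_value_lin[OF P']] conj
        by metis
    qed
  qed
  obtain k A' B' where *: "A = [:- u, 1:] ^ k * A'" "B = [:- u, 1:] ^ k * B'"
      and prim': "poly A' u \<noteq> 0 \<or> poly B' u \<noteq> 0"
    using common_root_split[OF nz] .
  then have nz': "lin A' B' \<noteq> 0" "lin (conj1 A' B') (- B') \<noteq> 0"
    by auto
  have "lin A B = (x - emb F u) ^ k * lin A' B'"
    unfolding * lin_scale by (simp only: subst1_power subst1_linear)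
  moreover have "lin (conj1 A B) (- B) = (x - emb F u) ^ k * lin (conj1 A' B') (- B')"
  proof -
    have "conj1 A B = [:- u, 1:] ^ k * conj1 A' B'" "- B = [:- u, 1:] ^ k * - B'"
      unfolding * by (simp_all add: algebra_simps)
    then show ?thesis
      by (simp only: lin_scale subst1_power subst1_linear)
  qed
  ultimately show ?thesis
    using prim[OF prim'] ram nz' xu_nonzero[of u]
    by (simp add: val_mult P P' val_power lin_in_K val_xu del: diff_diff_add)
qed

text \<open>The norm is \<open>lin A B\<close> times its conjugate, and \<open>val_conj\<close>
  moves the conjugate to the opposite point. At a ramified point the two points coincide, and both
  sides of the resulting equation are halved; this explains the 0 in the statement.\<close>

lemma val_norm:
  assumes P: "Affine u v \<in> curve_points E" and nz: "A \<noteq> 0 \<or> B \<noteq> 0"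
  shows "\<nu> (Affine u v) (lin A B) + (if ramified u v then 0 else \<nu> (Affine u (- v - poly h u)) (lin A B))
    = Polynomial.order u (nrm A B)"
proof -
  have nz': "lin A B \<noteq> 0" "lin (conj1 A B) (- B) \<noteq> 0" "nrm A B \<noteq> 0"
    using nz by auto
  have "\<nu> (Affine u v) (lin A B) + \<nu> (Affine u (- v - poly h u)) (lin A B)
    = \<nu> (Affine u v) (subst1 x (nrm A B))"
    unfolding val_conj[OF assms] using val_mult[OF P lin_in_K nz'(1) lin_in_K nz'(2)]
    by (simp add: lin_conj)
  also have "\<dots> = Polynomial.order u (nrm A B) * (if ramified u v then 2 else 1)"
    using val_subst1[OF P nz'(3)] .
  finally have *: "\<nu> (Affine u v) (lin A B) + \<nu> (Affine u (- v - poly h u)) (lin A B)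
    = Polynomial.order u (nrm A B) * (if ramified u v then 2 else 1)" .
  show ?thesis
  proof (cases "ramified u v")
    case True
    then have eq: "- v - poly h u = v"
      by algebra
    show ?thesis
      using * True unfolding eq by simp
  next
    case False
    then show ?thesis
      using * by simp
  qed
qed

end

section \<open>Principal divisors and the group law\<close>

lemma sum_order_eq_degree:
  fixes p :: "'c::alg_closed_field poly"
  assumes "p \<noteq> 0"
  shows "(\<Sum>u | poly p u = 0. Polynomial.order u p) = degree p"
proof -
  obtain A where A: "size A = degree p" "p = smult (lead_coeff p) (\<Prod>x\<in>#A. [:- x, 1:])"
    using alg_closed_imp_factorization[OF assms] by blast
  have nz: "(\<Prod>x\<in>#B. [:- x, 1:]) \<noteq> 0" for B :: "'c multiset"
    by (auto simp: prod_mset_zero_iff)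
  have "proots (\<Prod>x\<in>#A. [:- x, 1:]) = A"
  proof (induction A)
    case (add z A)
    then show ?case
      using proots_mult[of "[:- z, 1:]", OF _ nz[of A]] by (simp del: mult_pCons_left)
  qed simp
  moreover have "proots p = proots (\<Prod>x\<in>#A. [:- x, 1:])"
    using assms by (subst A(2), subst proots_smult) auto
  ultimately have "size (proots p) = degree p"
    using A(1) by simp
  then show ?thesis
    using assms by (simp add: size_multiset_overloaded_eq)
qed

definition point_divisor :: "'c point \<Rightarrow> 'c point \<Rightarrow> int"
  where "point_divisor P Q = (if Q = P then 1 else 0)"

context elliptic_function_field
begin

abbreviation \<E> :: "'c point set" where "\<E> \<equiv> curve_points E"

abbreviation \<delta> :: "'c point \<Rightarrow> 'c point \<Rightarrow> int" where "\<delta> \<equiv> point_divisor"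

lemma Infinity_in_curve [simp]: "Infinity \<in> \<E>"
  by (simp add: curve_points_def)

section \<open>Functions without affine poles, and constants\<close>

lemma affine_point_exists: obtains v where "Affine u v \<in> \<E>"
proof -
  have "\<exists>v. poly [:- poly cubic u, poly h u, 1:] v = 0"
    by (rule alg_closed_imp_poly_has_root) simp
  then obtain v where "poly [:- poly cubic u, poly h u, 1:] v = 0"
    by blast
  then have "Affine u v \<in> \<E>"
    unfolding affine_in_curve by (simp add: algebra_simps)
  then show ?thesis
    by (rule that)
qed

lemma same_x:
  assumes "Affine u v \<in> \<E>" "Affine u w \<in> \<E>"
  shows "w = v \<or> w = - v - poly h u"
proof -
  have "(w - v) * (w - (- v - poly h u)) = (w * w + poly h u * w) - (v * v + poly h u * v)"
    by (simp add: algebra_simps)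
  then have "(w - v) * (w - (- v - poly h u)) = 0"
    using assms unfolding affine_in_curve by simp
  then show ?thesis
    by (simp add: eq_diff_eq)
qed

text \<open>This says that the coordinate ring is integrally closed. As long as the denominator has
  a root u, the absence of poles forces both coefficients of the numerator to vanish at u, so x - u
  cancels.\<close>

lemma regular_affine:
  assumes "f \<in> K" "f \<noteq> 0" "\<And>u v. Affine u v \<in> \<E> \<Longrightarrow> \<nu> (Affine u v) f \<ge> 0"
  obtains A B where "f = lin A B"
proof -
  have "\<exists>A' B'. f = lin A' B'" if "f = lin A B / subst1 x D" "D \<noteq> 0" for A B D
    using that
  proof (induction "degree D" arbitrary: A B D rule: less_induct)
    case less
    have nz: "A \<noteq> 0 \<or> B \<noteq> 0"
      using less.prems assms(2) by auto
    show ?case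
    proof (cases "degree D = 0")
      case True
      then obtain d where "D = [:d:]"
        using degree_eq_zeroE by blast
      then have "f = subst1 x [:inverse d:] * lin A B"
        using less.prems by (simp add: divide_inverse mult.commute)
      then show ?thesis
        by (metis lin_scale)
    next
      case False
      then obtain u where u: "poly D u = 0"
        using alg_closed_imp_poly_has_root by blast
      then obtain D' where D': "D = [:- u, 1:] * D'"
        using split_root by blast
      have val: "\<nu> (Affine u v) (lin A B) \<ge> (if ramified u v then 2 else 1)"
        if P: "Affine u v \<in> \<E>" for v
      proof -
        have "\<nu> (Affine u v) f = \<nu> (Affine u v) (lin A B) - \<nu> (Affine u v) (subst1 x D)"
          unfolding less.prems(1) using nz less.prems(2) by (intro val_divide P lin_in_K) auto
        moreover have "Polynomial.order u D \<ge> 1"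
          using u less.prems(2) order_root[of D u] by linarith
        then have "\<nu> (Affine u v) (subst1 x D) \<ge> (if ramified u v then 2 else 1)"
          unfolding val_subst1[OF P less.prems(2)] by simp
        ultimately show ?thesis
          using assms(3)[OF P] by linarith
      qed
      then have zero: "poly A u + poly B u * v = 0" if "Affine u v \<in> \<E>" for v
        using val_lin_pos_iff[OF that nz] that by (smt (verit))
      obtain v where P: "Affine u v \<in> \<E>"
        using affine_point_exists .
      \<comment> \<open>At a ramified point a primitive pair has order at most 1, against the bound
        2. Otherwise A(u) + B(u) v, which is linear in v, vanishes at two different
        ordinates.\<close>
      have "poly A u = 0 \<and> poly B u = 0"
      proof (cases "ramified u v")
        case True
        show ?thesis
          using val_ramified_primitive[OF P True _ zero[OF P]] val[OF P] True by fastforce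
      next
        case False
        have "Affine u (- v - poly h u) \<in> \<E>"
          using curve_neg_closed[OF P] by (simp only: curve_neg_affine)
        then have "poly A u + poly B u * (- v - poly h u) = 0"
          by (rule zero)
        then have "poly B u * (v + v + poly h u) = 0"
          using zero[OF P] by algebra
        then show ?thesis
          using False zero[OF P] by simp
      qed
      then obtain A' B' where AB: "A = [:- u, 1:] * A'" "B = [:- u, 1:] * B'"
        using split_root by metis
      have "f = lin A' B' / subst1 x D'"
        using less.prems(1) xu_nonzero[of u]
        unfolding AB D' lin_scale subst1_mult subst1_linear by simp
      moreover have "D' \<noteq> 0"
        using less.prems(2) D' by auto
      moreover from this have "degree D' < degree D"
        unfolding D' by (subst degree_mult_eq) auto
      ultimately show ?thesis
        using less.hyps by blast
    qed
  qed
  then show ?thesis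
    using that ff_carrierE[OF assms(1)] by metis
qed

text \<open>Without a pole at infinity the norm has degree 0. This excludes a y-term, which
  contributes at least 3, and a nonconstant A.\<close>

lemma no_zeros_constant:
  assumes "f \<in> K" "f \<noteq> 0" "\<And>P. P \<in> \<E> \<Longrightarrow> \<nu> P f \<ge> 0"
  obtains c where "c \<noteq> 0" "f = emb F c"
proof -
  obtain A B where f: "f = lin A B"
    using regular_affine assms by metis
  have nz: "A \<noteq> 0 \<or> B \<noteq> 0"
    using f assms(2) by auto
  have "degree (nrm A B) = 0"
    using assms(3)[of Infinity] val_infinity_lin[OF nz] f by simp
  then have "B = 0" "degree A = 0"
    using degree_norm[OF nz] by (auto split: if_splits)
  moreover from this obtain a where "A = [:a:]"
    using degree_eq_zeroE by blast
  ultimately show ?thesis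
    using that[of a] f assms(2) by (simp add: lin_def)
qed

section \<open>The divisor of a function has degree zero\<close>

definition fibre :: "'c \<Rightarrow> 'c point set"
  where "fibre u = {Affine u v |v. Affine u v \<in> \<E>}"

lemma fibre_eq:
  assumes "Affine u v \<in> \<E>"
  shows "fibre u = {Affine u v, Affine u (- v - poly h u)}"
  using assms same_x[OF assms] curve_neg_closed[OF assms]
  unfolding curve_neg_affine fibre_def by blast

lemma sum_fibre:
  assumes nz: "A \<noteq> 0 \<or> B \<noteq> 0"
  shows "finite (fibre u)" "(\<Sum>P\<in>fibre u. \<nu> P (lin A B)) = Polynomial.order u (nrm A B)"
proof -
  obtain v where P: "Affine u v \<in> \<E>"
    using affine_point_exists .
  show "finite (fibre u)"
    unfolding fibre_eq[OF P] by simp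
  have ram: "ramified u v \<longleftrightarrow> - v - poly h u = v"
    by algebra
  show "(\<Sum>P\<in>fibre u. \<nu> P (lin A B)) = Polynomial.order u (nrm A B)"
  proof (cases "- v - poly h u = v")
    case True
    then show ?thesis
      using val_norm[OF P nz] unfolding fibre_eq[OF P] ram True by simp
  next
    case False
    then show ?thesis
      using val_norm[OF P nz] unfolding fibre_eq[OF P] ram by simp
  qed
qed

lemma degree_lin_divisor:
  assumes nz: "A \<noteq> 0 \<or> B \<noteq> 0"
  obtains S where "finite S" "S \<subseteq> \<E>" "\<And>P. P \<in> \<E> - S \<Longrightarrow> \<nu> P (lin A B) = 0"
    "(\<Sum>P\<in>S. \<nu> P (lin A B)) = 0"
proof -
  define U where "U = {u. poly (nrm A B) u = 0}"
  have N: "nrm A B \<noteq> 0"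
    using nz by simp
  have U: "finite U"
    unfolding U_def using N by (rule poly_roots_finite)
  define T where "T = (\<Union>u\<in>U. fibre u)"
  have T: "finite T" "T \<subseteq> \<E>" "Infinity \<notin> T"
    unfolding T_def using U sum_fibre(1)[OF nz] by (auto simp: fibre_def)
  have "(\<Sum>P\<in>T. \<nu> P (lin A B)) = (\<Sum>u\<in>U. \<Sum>P\<in>fibre u. \<nu> P (lin A B))"
    unfolding T_def using U sum_fibre(1)[OF nz]
    by (intro sum.UNION_disjoint) (auto simp: fibre_def)
  also have "\<dots> = int (\<Sum>u\<in>U. Polynomial.order u (nrm A B))"
    unfolding sum_fibre(2)[OF nz] by simp
  also have "\<dots> = degree (nrm A B)"
    unfolding U_def sum_order_eq_degree[OF N] ..
  finally have "(\<Sum>P\<in>insert Infinity T. \<nu> P (lin A B)) = 0"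
    using T val_infinity_lin[OF nz] by simp
  moreover have "\<nu> P (lin A B) = 0" if "P \<in> \<E> - insert Infinity T" for P
  proof -
    have "P \<in> \<E>" "P \<noteq> Infinity"
      using that by auto
    then obtain u v where P: "P = Affine u v" "Affine u v \<in> \<E>"
      by (cases P) auto
    then have "u \<notin> U"
      using that by (auto simp: T_def fibre_def)
    then have "Polynomial.order u (nrm A B) = 0"
      using order_root[of "nrm A B" u] by (auto simp: U_def)
    moreover have "\<nu> (Affine u (- v - poly h u)) (lin A B) \<ge> 0"
      using val_lin_nonneg[OF _ nz] curve_neg_closed[OF P(2)] by (simp only: curve_neg_affine)
    ultimately show ?thesis
      using val_norm[OF P(2) nz] val_lin_nonneg[OF P(2) nz] P(1) by (auto split: if_splits)
  qed
  ultimately show ?thesis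
    using that[of "insert Infinity T"] T by auto
qed

lemma degree_divisor_superset:
  assumes "finite S" "S \<subseteq> \<E>" "\<And>P. P \<in> \<E> - S \<Longrightarrow> D P = (0::int)"
    and "finite T" "S \<subseteq> T" "T \<subseteq> \<E>"
  shows "sum D T = sum D S"
  using assms by (intro sum.mono_neutral_right) auto

lemma degree_divisor:
  assumes "f \<in> K" "f \<noteq> 0"
  obtains S where "finite S" "S \<subseteq> \<E>" "\<And>P. P \<in> \<E> - S \<Longrightarrow> \<nu> P f = 0" "(\<Sum>P\<in>S. \<nu> P f) = 0"
proof -
  obtain A B D where f: "D \<noteq> 0" "f = lin A B / lin D 0"
    using ff_carrierE[OF assms(1)] subst1_lin by metis
  then have nz: "A \<noteq> 0 \<or> B \<noteq> 0" "D \<noteq> 0 \<or> (0::'c poly) \<noteq> 0"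
    using assms(2) by auto
  have val: "\<nu> P f = \<nu> P (lin A B) - \<nu> P (lin D 0)" if "P \<in> \<E>" for P
    unfolding f(2) using nz that by (intro val_divide lin_in_K) auto
  obtain S where S: "finite S" "S \<subseteq> \<E>" "\<And>P. P \<in> \<E> - S \<Longrightarrow> \<nu> P (lin A B) = 0"
    "(\<Sum>P\<in>S. \<nu> P (lin A B)) = 0"
    using degree_lin_divisor[OF nz(1)] by blast
  obtain T where T: "finite T" "T \<subseteq> \<E>" "\<And>P. P \<in> \<E> - T \<Longrightarrow> \<nu> P (lin D 0) = 0"
    "(\<Sum>P\<in>T. \<nu> P (lin D 0)) = 0"
    using degree_lin_divisor[OF nz(2)] by blast
  have "(\<Sum>P\<in>S\<union>T. \<nu> P f) = (\<Sum>P\<in>S\<union>T. \<nu> P (lin A B)) - (\<Sum>P\<in>S\<union>T. \<nu> P (lin D 0))"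
    unfolding sum_subtractf[symmetric] using S T val by (intro sum.cong) auto
  then have "(\<Sum>P\<in>S\<union>T. \<nu> P f) = 0"
    using degree_divisor_superset[of S "\<lambda>P. \<nu> P (lin A B)" "S \<union> T"]
      degree_divisor_superset[of T "\<lambda>P. \<nu> P (lin D 0)" "S \<union> T"] S T by simp
  then show ?thesis
    using that[of "S \<union> T"] S T val by auto
qed

section \<open>Principal divisors\<close>

definition principal :: "('c point \<Rightarrow> int) \<Rightarrow> bool"
  where "principal D \<longleftrightarrow> (\<exists>f\<in>K. f \<noteq> 0 \<and> (\<forall>P\<in>\<E>. \<nu> P f = D P))"

lemma principalI: "f \<in> K \<Longrightarrow> f \<noteq> 0 \<Longrightarrow> (\<And>P. P \<in> \<E> \<Longrightarrow> D P = \<nu> P f) \<Longrightarrow> principal D"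
  unfolding principal_def by auto

lemma principal_cong: "principal D \<Longrightarrow> (\<And>P. P \<in> \<E> \<Longrightarrow> D' P = D P) \<Longrightarrow> principal D'"
  unfolding principal_def by fastforce

lemma principal_0: "(\<And>P. P \<in> \<E> \<Longrightarrow> D P = 0) \<Longrightarrow> principal D"
  by (rule principalI[of 1]) auto

lemma principal_add:
  assumes "principal D" "principal D'" "\<And>P. P \<in> \<E> \<Longrightarrow> D'' P = D P + D' P"
  shows "principal D''"
proof -
  obtain f g where "f \<in> K" "f \<noteq> 0" "\<forall>P\<in>\<E>. \<nu> P f = D P" "g \<in> K" "g \<noteq> 0" "\<forall>P\<in>\<E>. \<nu> P g = D' P"
    using assms(1,2) unfolding principal_def by blast
  then show ?thesis
    by (intro principalI[of "f * g"]) (auto simp: val_mult assms(3))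
qed

lemma principal_diff:
  assumes "principal D" "principal D'" "\<And>P. P \<in> \<E> \<Longrightarrow> D'' P = D P - D' P"
  shows "principal D''"
proof -
  obtain f g where "f \<in> K" "f \<noteq> 0" "\<forall>P\<in>\<E>. \<nu> P f = D P" "g \<in> K" "g \<noteq> 0" "\<forall>P\<in>\<E>. \<nu> P g = D' P"
    using assms(1,2) unfolding principal_def by blast
  then show ?thesis
    by (intro principalI[of "f / g"]) (auto simp: val_divide assms(3))
qed

lemma principal_degree_0:
  assumes "principal D" "finite S" "S \<subseteq> \<E>" "\<And>P. P \<in> \<E> - S \<Longrightarrow> D P = 0"
  shows "sum D S = 0"
proof -
  obtain f where f: "f \<in> K" "f \<noteq> 0" "\<And>P. P \<in> \<E> \<Longrightarrow> \<nu> P f = D P"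
    using assms(1) principal_def by auto
  obtain T where T: "finite T" "T \<subseteq> \<E>" "\<And>P. P \<in> \<E> - T \<Longrightarrow> \<nu> P f = 0" "(\<Sum>P\<in>T. \<nu> P f) = 0"
    using degree_divisor[OF f(1,2)] by blast
  have "sum D (S \<union> T) = sum D S" "sum D (S \<union> T) = sum D T"
    using degree_divisor_superset[of S D "S \<union> T"] degree_divisor_superset[of T D "S \<union> T"]
      assms T f by auto
  moreover have "sum D T = (\<Sum>P\<in>T. \<nu> P f)"
    using f T by (intro sum.cong) auto
  ultimately show ?thesis
    using T(4) by simp
qed

lemma degree_norm_neq_1: "A \<noteq> 0 \<or> B \<noteq> 0 \<Longrightarrow> degree (nrm A B) \<noteq> 1"
  by (simp add: degree_norm max_def)

text \<open>The divisor of a vertical line. At a ramified point the two affine terms coincide and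
  add up to the order 2.\<close>

lemma val_xu_divisor:
  assumes "Affine u v \<in> \<E>" "P \<in> \<E>"
  shows "\<nu> P (x - emb F u) = \<delta> (Affine u v) P + \<delta> (curve_neg E (Affine u v)) P - 2 * \<delta> Infinity P"
proof (cases P)
  case Infinity
  have "x - emb F u = lin [:- u, 1:] 0"
    by (simp add: lin_def)
  then show ?thesis
    using Infinity val_infinity_lin[of "[:- u, 1:]" 0] by (simp add: norm_subst1 point_divisor_def)
next
  case (Affine u' v')
  show ?thesis
  proof (cases "u' = u")
    case True
    then have "v' = v \<or> v' = - v - poly h u"
      using same_x assms Affine by blast
    moreover have "ramified u v \<longleftrightarrow> - v - poly h u = v" "ramified u v' \<longleftrightarrow> - v' - poly h u = v'"
      by algebra+
    moreover have "v' = - v - poly h u \<longleftrightarrow> v = - v' - poly h u"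
      by algebra
    ultimately show ?thesis
      using Affine True val_xu[of u v'] assms
      by (auto simp: point_divisor_def curve_neg_affine simp del: curve_neg.simps)
  next
    case False
    then show ?thesis
      using Affine assms val_unit[OF _ has_value_subst1, of u' v' "[:- u, 1:]"]
      by (simp add: point_divisor_def)
  qed
qed

text \<open>If Q is the origin, f is a ring element with a simple pole at infinity, so its norm has
  degree 1. For affine Q, the factor x - u trades the pole at Q for a zero at the opposite point and
  a double pole at infinity. The product then has a norm of degree 1, which is impossible, or 2. In
  the latter case it is linear in x and vanishes at u, so it is a constant times x - u, and f is
  constant.\<close>

lemma principal_point_diff:
  assumes P: "P \<in> \<E>" and Q: "Q \<in> \<E>" and "principal (\<lambda>S. \<delta> P S - \<delta> Q S)"
  shows "P = Q"
proof (rule ccontr)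
  assume "P \<noteq> Q"
  obtain f where f: "f \<in> K" "f \<noteq> 0" "\<And>S. S \<in> \<E> \<Longrightarrow> \<nu> S f = \<delta> P S - \<delta> Q S"
    using assms(3) principal_def by auto
  show False
  proof (cases Q)
    case Infinity
    have "\<nu> (Affine u v) f \<ge> 0" if "Affine u v \<in> \<E>" for u v
      using f(3)[OF that] Infinity by (simp add: point_divisor_def)
    then obtain A B where AB: "f = lin A B"
      using regular_affine f by metis
    then have nz: "A \<noteq> 0 \<or> B \<noteq> 0"
      using f(2) by auto
    have "\<nu> Infinity f = - 1"
      using f(3)[of Infinity] Infinity \<open>P \<noteq> Q\<close> by (auto simp: point_divisor_def)
    then show False
      using degree_norm_neq_1[OF nz] val_infinity_lin[OF nz] AB by simp
  next
    case (Affine u v)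
    let ?g = "f * (x - emb F u)"
    have g: "?g \<in> K" "?g \<noteq> 0"
      using f xu_nonzero by auto
    have val: "\<nu> S ?g = \<delta> P S + \<delta> (curve_neg E Q) S - 2 * \<delta> Infinity S" if "S \<in> \<E>" for S
      using val_mult[OF that f(1,2) _ xu_nonzero[of u]] f(3)[OF that]
        val_xu_divisor[OF _ that, of u v] Affine Q by auto
    then have "\<nu> (Affine u' v') ?g \<ge> 0" if "Affine u' v' \<in> \<E>" for u' v'
      using that by (simp add: point_divisor_def)
    then obtain A B where AB: "?g = lin A B"
      using regular_affine g by metis
    then have nz: "A \<noteq> 0 \<or> B \<noteq> 0"
      using g(2) by auto
    have deg: "- int (degree (nrm A B)) = \<delta> P Infinity - 2"
      using val[of Infinity] val_infinity_lin[OF nz] Affine unfolding AB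
      by (simp add: point_divisor_def)
    then have "P \<noteq> Infinity"
      using degree_norm_neq_1[OF nz] by (auto simp: point_divisor_def)
    then have "degree (nrm A B) = 2"
      using deg by (simp add: point_divisor_def split: if_splits)
    then have B: "B = 0" and A: "degree A = 1"
      using degree_norm[OF nz] by (auto split: if_splits)
    have Q': "curve_neg E Q \<in> \<E>"
      using Q by (rule curve_neg_closed)
    have "\<nu> (curve_neg E Q) ?g > 0"
      using val[OF Q'] Affine by (simp add: point_divisor_def)
    then have "poly A u = 0"
      using val_lin_pos_iff[of u "- v - poly h u" A B] nz B Q' Affine unfolding AB
      by (simp add: curve_neg_affine del: curve_neg.simps)
    then obtain q where q: "A = [:- u, 1:] * q"
      using split_root by blast
    then have "q \<noteq> 0"
      using nz B by auto
    then have "degree q = 0"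
      using A degree_mult_eq[of "[:- u, 1:]" q] unfolding q by simp
    then obtain a where a: "q = [:a:]"
      using degree_eq_zeroE by blast
    have "f * (x - emb F u) = emb F a * (x - emb F u)"
      unfolding AB B q a by (simp add: lin_def algebra_simps)
    then have "f = emb F a" "a \<noteq> 0"
      using xu_nonzero[of u] \<open>q \<noteq> 0\<close> a by auto
    then have "\<nu> P f = 0"
      using val_emb[OF P] by simp
    then show False
      using f(3)[OF P] \<open>P \<noteq> Q\<close> by (simp add: point_divisor_def)
  qed
qed

section \<open>Chords, tangents and the group law\<close>

lemma val_primitive:
  assumes P: "Affine u v \<in> \<E>" and prim: "poly A u \<noteq> 0 \<or> poly B u \<noteq> 0"
  shows "\<nu> (Affine u v) (lin A B)
    = (if poly A u + poly B u * v = 0 then Polynomial.order u (nrm A B) else 0)"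
proof -
  have nz: "A \<noteq> 0 \<or> B \<noteq> 0"
    using prim by auto
  show ?thesis
    using val_norm[OF P nz] val_unramified_primitive[OF P _ prim] val_lin_zero_iff[OF P nz]
    by (cases "ramified u v") auto
qed

text \<open>The function y - l x - m has y-coefficient 1, so it is primitive over every u. At a
  point of the line its order is therefore the multiplicity of u as a root of the norm, and the line
  has just one point over each u.\<close>

lemma line_principal:
  assumes P: "Affine x1 y1 \<in> \<E>" and Q: "Affine x2 y2 \<in> \<E>" and R: "Affine x3 (l * x3 + m) \<in> \<E>"
    and y1: "y1 = l * x1 + m" and y2: "y2 = l * x2 + m"
    and N: "nrm [:- m, - l:] 1 = - ([:- x1, 1:] * [:- x2, 1:] * [:- x3, 1:])"
  shows "principal (\<lambda>S. \<delta> (Affine x1 y1) S + \<delta> (Affine x2 y2) S + \<delta> (Affine x3 (l * x3 + m)) S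
    - 3 * \<delta> Infinity S)"
proof (rule principalI[of "lin [:- m, - l:] 1"])
  fix S
  assume S: "S \<in> \<E>"
  show "\<delta> (Affine x1 y1) S + \<delta> (Affine x2 y2) S + \<delta> (Affine x3 (l * x3 + m)) S
    - 3 * \<delta> Infinity S = \<nu> S (lin [:- m, - l:] 1)"
  proof (cases S)
    case Infinity
    then show ?thesis
      using val_infinity_lin[of "[:- m, - l:]" 1] degree_norm[of "[:- m, - l:]" 1]
      by (simp add: point_divisor_def max_def)
  next
    case (Affine u v)
    have order: "Polynomial.order u [:- z, 1:] = (if u = z then 1 else 0)" for z
      using order_power_n_n[of z 1] order_root[of "[:- z, 1:]" u] by auto
    have "Polynomial.order u (nrm [:- m, - l:] 1)
      = (if u = x1 then 1 else 0) + (if u = x2 then 1 else 0) + (if u = x3 then 1 else 0)"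
      unfolding N order_uminus by (simp add: order_mult order del: mult_pCons_left mult_pCons_right)
    moreover have "poly [:- m, - l:] u + poly 1 u * v = 0 \<longleftrightarrow> v = l * u + m"
      by simp algebra
    ultimately have "\<nu> S (lin [:- m, - l:] 1) = (if v = l * u + m then
        (if u = x1 then 1 else 0) + (if u = x2 then 1 else 0) + (if u = x3 then 1 else 0) else 0)"
      using val_primitive[of u v "[:- m, - l:]" 1] S Affine by simp
    then show ?thesis
      using Affine y1 y2 by (auto simp: point_divisor_def)
  qed
qed (use lin_in_K in auto)

text \<open>The line through P and Q has divisor P + Q + R - 3 o and the vertical line through R has
  divisor R + (P \<oplus> Q) - 2 o; the difference is the claim. For opposite points the vertical
  line through P suffices.\<close>

lemma curve_add_principal:
  assumes "P \<in> \<E>" "Q \<in> \<E>"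
  shows "curve_add E P Q \<in> \<E> \<and>
    principal (\<lambda>S. \<delta> P S + \<delta> Q S - \<delta> (curve_add E P Q) S - \<delta> Infinity S)"
proof (cases "P = Infinity \<or> Q = Infinity")
  case True
  then show ?thesis
    using assms by (cases P; cases Q) (auto intro: principal_0)
next
  case False
  then obtain x1 y1 x2 y2 where PQ: "P = Affine x1 y1" "Q = Affine x2 y2"
    by (meson point.exhaust)
  have on1: "y1 * y1 + poly h x1 * y1 = poly cubic x1" and on2: "y2 * y2 + poly h x2 * y2 = poly cubic x2"
    using assms unfolding PQ affine_in_curve by auto
  have poly_c: "poly cubic u = A6 E + A4 E * u + A2 E * u * u + u * u * u" for u
    by (simp add: cubic_def algebra_simps)
  show ?thesis
  proof (cases "x1 = x2 \<and> y1 + y2 + A1 E * x2 + A3 E = 0")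
    case True
    then have "Q = curve_neg E P"
      unfolding PQ by (simp add: algebra_simps eq_neg_iff_add_eq_0)
    then show ?thesis
      using True PQ val_xu_divisor[of x1 y1] assms xu_nonzero[of x1]
      by (auto intro!: principalI[of "x - emb F x1"])
  next
    case nontriv: False
    define l where "l = (if x1 = x2
                  then (3 * x1 ^ 2 + 2 * A2 E * x1 + A4 E - A1 E * y1)
                         / (2 * y1 + A1 E * x1 + A3 E)
                  else (y2 - y1) / (x2 - x1))"
    define m where "m = y1 - l * x1"
    define x3 where "x3 = l ^ 2 + A1 E * l - A2 E - x1 - x2"
    have sum: "curve_add E P Q = Affine x3 (- l * (x3 - x1) - y1 - A1 E * x3 - A3 E)"
      unfolding PQ curve_add.simps(3) using nontriv by (simp add: Let_def l_def x3_def)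
    have y1: "y1 = l * x1 + m"
      by (simp add: m_def)
    \<comment> \<open>These are the coefficients of x and 1 in the factorisation of the norm below;
      the coefficient of x^2 is the definition of x3. For a tangent, the slope equation says that x1
      is a double root.\<close>
    have coeffs: "y2 = l * x2 + m \<and> x1 * x2 + x1 * x3 + x2 * x3 = A4 E - 2 * l * m - A1 E * m - A3 E * l \<and>
      - x1 * x2 * x3 = A6 E - m * m - A3 E * m"
    proof (cases "x1 = x2")
      case True
      have "y2 = y1"
        using same_x[of x1 y1 y2] assms nontriv True unfolding PQ poly_h by auto
      then have "2 * y1 + A1 E * x1 + A3 E \<noteq> 0"
        using nontriv True by (simp add: algebra_simps)
      then have l: "l * (2 * y1 + A1 E * x1 + A3 E) = 3 * x1 ^ 2 + 2 * A2 E * x1 + A4 E - A1 E * y1"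
        using True by (simp add: l_def)
      have "x1 * x1 + x1 * x3 + x1 * x3 = A4 E - 2 * l * m - A1 E * m - A3 E * l"
        using l unfolding x3_def m_def True by algebra
      moreover from this have "- x1 * x1 * x3 = A6 E - m * m - A3 E * m"
        using on1 y1 x3_def True unfolding poly_c poly_h by algebra
      ultimately show ?thesis
        using True \<open>y2 = y1\<close> y1 by simp
    next
      case False
      then have l: "l * (x2 - x1) = y2 - y1"
        by (simp add: l_def)
      then have y2: "y2 = l * x2 + m"
        unfolding m_def by algebra
      let ?c = "x1 * x2 + x1 * x3 + x2 * x3 - (A4 E - 2 * l * m - A1 E * m - A3 E * l)"
      \<comment> \<open>The difference of the curve equations at the two points has the factor x2 -
        x1.\<close>
      have "(x2 - x1) * ?c = 0"
        using on1 on2 y1 y2 x3_def unfolding poly_c poly_h by algebra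
      then have "?c = 0"
        using False by simp
      moreover from this have "- x1 * x2 * x3 = A6 E - m * m - A3 E * m"
        using on1 y1 x3_def unfolding poly_c poly_h by algebra
      ultimately show ?thesis
        using y2 by simp
    qed
    have N: "nrm [:- m, - l:] 1 = - ([:- x1, 1:] * [:- x2, 1:] * [:- x3, 1:])"
    proof -
      have "A6 E = - x1 * x2 * x3 + m * m + A3 E * m"
        "A4 E = x1 * x2 + x1 * x3 + x2 * x3 + 2 * l * m + A1 E * m + A3 E * l"
        "A2 E = l * l + A1 E * l - x3 - x1 - x2"
        using coeffs by (simp_all add: x3_def power2_eq_square)
      then show ?thesis
        by (simp add: nrm_def h_def cubic_def algebra_simps)
    qed
    \<comment> \<open>The norm of y - l x - m is the Weierstrass polynomial evaluated at (x, l x +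
      m), so a root gives a point of the curve.\<close>
    have "poly (nrm [:- m, - l:] 1) x3 = 0"
      unfolding N by (simp only: poly_minus poly_mult) simp
    then have R: "Affine x3 (l * x3 + m) \<in> \<E>"
      unfolding affine_in_curve nrm_def by (simp add: algebra_simps)
    let ?R = "Affine x3 (l * x3 + m)"
    have neg: "curve_add E P Q = curve_neg E ?R"
      unfolding sum m_def by (simp add: algebra_simps)
    have vertical: "principal (\<lambda>S. \<delta> ?R S + \<delta> (curve_neg E ?R) S - 2 * \<delta> Infinity S)"
      using val_xu_divisor[OF R] xu_nonzero[of x3] by (intro principalI[of "x - emb F x3"]) auto
    have line: "principal (\<lambda>S. \<delta> P S + \<delta> Q S + \<delta> ?R S - 3 * \<delta> Infinity S)"
      unfolding PQ using line_principal[OF _ _ R y1 _ N, of y2] coeffs assms PQ by simp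
    show ?thesis
      unfolding neg
    proof
      show "principal (\<lambda>S. \<delta> P S + \<delta> Q S - \<delta> (curve_neg E ?R) S - \<delta> Infinity S)"
        by (rule principal_diff[OF line vertical]) simp
    qed (rule curve_neg_closed[OF R])
  qed
qed

lemma curve_add_closed: "P \<in> \<E> \<Longrightarrow> Q \<in> \<E> \<Longrightarrow> curve_add E P Q \<in> \<E>"
  and principal_curve_add: "P \<in> \<E> \<Longrightarrow> Q \<in> \<E> \<Longrightarrow>
    principal (\<lambda>S. \<delta> P S + \<delta> Q S - \<delta> (curve_add E P Q) S - \<delta> Infinity S)"
  using curve_add_principal by blast+

lemma curve_add_neg: "curve_add E (curve_neg E P) P = Infinity"
  by (cases P) auto

lemma curve_add_commute:
  assumes "P \<in> \<E>" "Q \<in> \<E>"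
  shows "curve_add E P Q = curve_add E Q P"
proof (rule principal_point_diff)
  show "principal (\<lambda>S. \<delta> (curve_add E P Q) S - \<delta> (curve_add E Q P) S)"
    by (rule principal_diff[OF principal_curve_add[OF assms(2,1)] principal_curve_add[OF assms]]) simp
qed (use assms curve_add_closed in auto)

lemma curve_add_assoc:
  assumes "P \<in> \<E>" "Q \<in> \<E>" "R \<in> \<E>"
  shows "curve_add E (curve_add E P Q) R = curve_add E P (curve_add E Q R)"
proof (rule principal_point_diff)
  let ?PQ = "curve_add E P Q" and ?QR = "curve_add E Q R"
  have 1: "principal (\<lambda>S. \<delta> P S + \<delta> Q S + \<delta> R S - \<delta> (curve_add E ?PQ R) S - 2 * \<delta> Infinity S)"
    by (rule principal_add[OF principal_curve_add[of P Q] principal_curve_add[of ?PQ R]])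
      (use assms curve_add_closed in auto)
  have 2: "principal (\<lambda>S. \<delta> P S + \<delta> Q S + \<delta> R S - \<delta> (curve_add E P ?QR) S - 2 * \<delta> Infinity S)"
    by (rule principal_add[OF principal_curve_add[of Q R] principal_curve_add[of P ?QR]])
      (use assms curve_add_closed in auto)
  show "principal (\<lambda>S. \<delta> (curve_add E ?PQ R) S - \<delta> (curve_add E P ?QR) S)"
    by (rule principal_diff[OF 2 1]) auto
qed (use assms curve_add_closed in auto)

abbreviation G :: "'c point monoid" where "G \<equiv> curve_group E"

lemma carrier_G [simp]: "carrier G = \<E>" and one_G [simp]: "\<one>\<^bsub>G\<^esub> = Infinity"
  and mult_G [simp]: "P \<otimes>\<^bsub>G\<^esub> Q = curve_add E P Q"
  by (simp_all add: curve_group_def)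

sublocale curve: comm_group G
proof (rule comm_groupI)
  fix P
  assume "P \<in> carrier G"
  then show "\<exists>Q\<in>carrier G. Q \<otimes>\<^bsub>G\<^esub> P = \<one>\<^bsub>G\<^esub>"
    using curve_add_neg[of P] curve_neg_closed by auto
qed (simp_all add: curve_add_closed curve_add_assoc, rule curve_add_commute)

section \<open>Abel's theorem\<close>

lemma principal_nat_multiple:
  fixes n :: nat
  assumes "P \<in> \<E>"
  shows "principal (\<lambda>S. n * (\<delta> P S - \<delta> Infinity S) - (\<delta> (P [^]\<^bsub>G\<^esub> n) S - \<delta> Infinity S))"
proof (induction n)
  case 0
  then show ?case
    by (auto intro: principal_0)
next
  case (Suc n)
  have "P [^]\<^bsub>G\<^esub> n \<in> \<E>"
    using assms curve.nat_pow_closed[of P n] by simp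
  then have "principal (\<lambda>S. \<delta> (P [^]\<^bsub>G\<^esub> n) S + \<delta> P S - \<delta> (P [^]\<^bsub>G\<^esub> Suc n) S - \<delta> Infinity S)"
    using principal_curve_add[OF _ assms] by simp
  then show ?case
    by (rule principal_add[OF Suc]) (auto simp: algebra_simps)
qed

lemma principal_int_multiple:
  fixes n :: int
  assumes P: "P \<in> \<E>"
  shows "principal (\<lambda>S. n * (\<delta> P S - \<delta> Infinity S) - (\<delta> (P [^]\<^bsub>G\<^esub> n) S - \<delta> Infinity S))"
proof (cases "n \<ge> 0")
  case True
  then have "P [^]\<^bsub>G\<^esub> n = P [^]\<^bsub>G\<^esub> nat n"
    by (metis int_nat_eq int_pow_int)
  moreover have "int (nat n) = n"
    using True by simp
  ultimately show ?thesis
    using principal_nat_multiple[OF P, of "nat n"] by metis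
next
  case False
  let ?Q = "P [^]\<^bsub>G\<^esub> nat (- n)" and ?Q' = "P [^]\<^bsub>G\<^esub> n"
  have Q: "?Q \<in> \<E>" "?Q' \<in> \<E>"
    using curve.nat_pow_closed[of P "nat (- n)"] curve.int_pow_closed[of P n]
    unfolding carrier_G using P by blast+
  have "?Q' = inv\<^bsub>G\<^esub> ?Q"
    using False int_pow_def2[of G P n] by (simp only: not_le if_True)
  then have "curve_add E ?Q ?Q' = Infinity"
    using curve.r_inv[of ?Q] Q(1) unfolding carrier_G one_G mult_G by metis
  then have 1: "principal (\<lambda>S. \<delta> ?Q S + \<delta> ?Q' S - 2 * \<delta> Infinity S)"
    by (intro principal_cong[OF principal_curve_add[OF Q]]) simp
  have 2: "principal (\<lambda>S. (- n) * (\<delta> P S - \<delta> Infinity S) + \<delta> ?Q' S - \<delta> Infinity S)"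
    by (rule principal_add[OF principal_nat_multiple[OF P, of "nat (- n)"] 1])
      (use False in simp)
  show ?thesis
    by (rule principal_diff[OF principal_0[of "\<lambda>_. 0"] 2]) (simp_all add: algebra_simps)
qed

lemma principal_sum:
  assumes "finite S" "S \<subseteq> \<E>"
  shows "principal (\<lambda>Q. (\<Sum>P\<in>S. D P * (\<delta> P Q - \<delta> Infinity Q))
    - (\<delta> (\<Otimes>\<^bsub>G\<^esub>P\<in>S. P [^]\<^bsub>G\<^esub> D P) Q - \<delta> Infinity Q))"
  using assms
proof (induction S)
  case empty
  then show ?case
    by (auto intro: principal_0)
next
  case (insert R S)
  let ?T = "\<Otimes>\<^bsub>G\<^esub>P\<in>S. P [^]\<^bsub>G\<^esub> D P" and ?R = "R [^]\<^bsub>G\<^esub> D R"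
  have pow: "(\<lambda>P. P [^]\<^bsub>G\<^esub> D P) \<in> insert R S \<rightarrow> carrier G"
    using insert.prems by (intro funcsetI curve.int_pow_closed) auto
  then have prod: "(\<Otimes>\<^bsub>G\<^esub>P\<in>insert R S. P [^]\<^bsub>G\<^esub> D P) = curve_add E ?R ?T"
    using insert.hyps curve.finprod_insert[of S R "\<lambda>P. P [^]\<^bsub>G\<^esub> D P"] by auto
  have "?T \<in> \<E>" "?R \<in> \<E>"
    using pow curve.finprod_closed[of "\<lambda>P. P [^]\<^bsub>G\<^esub> D P" S] by auto
  then have 1: "principal (\<lambda>Q. \<delta> ?R Q + \<delta> ?T Q - \<delta> (curve_add E ?R ?T) Q - \<delta> Infinity Q)"
    using principal_curve_add by blast
  have "R \<in> \<E>"
    using insert.prems by simp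
  have IH: "principal (\<lambda>Q. (\<Sum>P\<in>S. D P * (\<delta> P Q - \<delta> Infinity Q)) - (\<delta> ?T Q - \<delta> Infinity Q))"
    using insert by simp
  have 2: "principal (\<lambda>Q. (\<Sum>P\<in>insert R S. D P * (\<delta> P Q - \<delta> Infinity Q))
     - (\<delta> ?R Q + \<delta> ?T Q - 2 * \<delta> Infinity Q))"
    by (rule principal_add[OF IH principal_int_multiple[OF \<open>R \<in> \<E>\<close>, of "D R"]])
      (use insert.hyps in simp)
  show ?case
    unfolding prod by (rule principal_add[OF 2 1]) simp
qed

text \<open>In degree 0, \<open>principal_sum\<close> reduces D modulo principal divisors to T - o,
  where T is the group sum of D; by \<open>principal_point_diff\<close> this is principal only for T
  = o.\<close>

theorem principal_iff:
  assumes S: "finite S" "S \<subseteq> \<E>" and D: "\<And>P. P \<in> \<E> - S \<Longrightarrow> D P = 0"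
  shows "principal D \<longleftrightarrow> sum D S = 0 \<and> (\<Otimes>\<^bsub>G\<^esub>P\<in>S. P [^]\<^bsub>G\<^esub> D P) = Infinity"
proof (cases "sum D S = 0")
  case False
  then show ?thesis
    using principal_degree_0[of D S] S D by auto
next
  case True
  let ?T = "\<Otimes>\<^bsub>G\<^esub>P\<in>S. P [^]\<^bsub>G\<^esub> D P"
  have "(\<lambda>P. P [^]\<^bsub>G\<^esub> D P) \<in> S \<rightarrow> carrier G"
    using S by (intro funcsetI curve.int_pow_closed) auto
  then have T: "?T \<in> \<E>"
    using curve.finprod_closed by fastforce
  \<comment> \<open>The terms at \<open>Infinity\<close> carry the total coefficient
    \<open>sum D S\<close>, which is 0.\<close>
  have "(\<Sum>P\<in>S. D P * (\<delta> P Q - \<delta> Infinity Q)) = D Q" if "Q \<in> \<E>" for Q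
  proof -
    have "(\<Sum>P\<in>S. D P * (\<delta> P Q - \<delta> Infinity Q)) = (\<Sum>P\<in>S. D P * \<delta> P Q) - sum D S * \<delta> Infinity Q"
      by (simp add: right_diff_distrib sum_subtractf sum_distrib_right)
    also have "(\<Sum>P\<in>S. D P * \<delta> P Q) = D Q"
      using D[of Q] that S(1) by (simp add: point_divisor_def if_distrib cong: if_cong)
    finally show ?thesis
      using True by simp
  qed
  then have 1: "principal (\<lambda>Q. D Q - (\<delta> ?T Q - \<delta> Infinity Q))"
    by (intro principal_cong[OF principal_sum[OF S, of D]]) auto
  have "principal D \<longleftrightarrow> principal (\<lambda>Q. \<delta> ?T Q - \<delta> Infinity Q)"
  proof
    assume "principal D"
    then show "principal (\<lambda>Q. \<delta> ?T Q - \<delta> Infinity Q)"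
      by (rule principal_diff[OF _ 1]) simp
  next
    assume "principal (\<lambda>Q. \<delta> ?T Q - \<delta> Infinity Q)"
    then show "principal D"
      by (rule principal_add[OF _ 1]) simp
  qed
  also have "\<dots> \<longleftrightarrow> ?T = Infinity"
    using principal_point_diff[OF T, of Infinity] principal_0[of "\<lambda>Q. \<delta> ?T Q - \<delta> Infinity Q"] by auto
  finally show ?thesis
    using True by simp
qed

end

section \<open>Translations and orbits\<close>

lemma sum'_eq_sum:
  assumes "finite S" "S \<subseteq> I" "\<And>i. i \<in> I - S \<Longrightarrow> f i = 0"
  shows "sum' f I = sum f S"
proof -
  have "sum' f I = sum' f S"
    using assms by (intro sum.mono_neutral_right') auto
  also have "\<dots> = sum f S"
    using assms(1) by (rule sum.eq_sum)
  finally show ?thesis .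
qed

lemma (in comm_monoid) gfinprod_eq_finprod_subset:
  assumes "finite S" "S \<subseteq> I" "\<And>i. i \<in> I - S \<Longrightarrow> f i = \<one>" "f \<in> I \<rightarrow> carrier G"
  shows "gfinprod G f I = finprod G f S"
proof -
  have "gfinprod G f I = gfinprod G f S"
    using assms by (intro gfinprod_mono_neutral_cong_right) auto
  also have "\<dots> = finprod G f S"
    using assms by (intro gfinprod_eq_finprod) auto
  finally show ?thesis .
qed

lemma (in comm_group) finprod_int_pow:
  fixes k :: "'i \<Rightarrow> int"
  assumes "x \<in> carrier G" "finite I"
  shows "(\<Otimes>i\<in>I. x [^] k i) = x [^] (\<Sum>i\<in>I. k i)"
  using assms(2)
proof (induction I)
  case (insert i I)
  have "(\<lambda>i. x [^] k i) \<in> I \<rightarrow> carrier G"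
    using assms(1) by auto
  then show ?case
    using insert assms(1) by (simp add: int_pow_mult)
qed simp

text \<open>Summation by parts; the zeros of g at - N and N + 1 remove the boundary terms.\<close>

lemma sum_weighted_difference:
  fixes g w :: "int \<Rightarrow> int"
  assumes "g (- N) = 0" "g (N + 1) = 0" "N \<ge> 0"
  shows "(\<Sum>n\<in>{- N..N}. w n * (g (n + 1) - g n)) = (\<Sum>n\<in>{- N..N}. (w (n - 1) - w n) * g n)"
proof -
  have I: "{- N..N + 1} = insert (- N) {- N + 1..N + 1}" "{- N..N + 1} = insert (N + 1) {- N..N}"
    using assms(3) by auto
  have "(\<Sum>n\<in>{- N..N}. w n * g (n + 1)) = (\<Sum>n\<in>{- N + 1..N + 1}. w (n - 1) * g n)"
    by (rule sum.reindex_bij_witness[of _ "\<lambda>n. n - 1" "\<lambda>n. n + 1"]) auto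
  also have "\<dots> = (\<Sum>n\<in>{- N..N + 1}. w (n - 1) * g n)"
    unfolding I(1) using assms(1) by simp
  also have "\<dots> = (\<Sum>n\<in>{- N..N}. w (n - 1) * g n)"
    unfolding I(2) using assms(2) by simp
  finally show ?thesis
    by (simp add: algebra_simps sum_subtractf)
qed

lemma finite_int_bounded:
  fixes A :: "int set"
  assumes "finite A"
  obtains N where "N > 0" "\<And>n. n \<in> A \<Longrightarrow> \<bar>n\<bar> < N"
proof -
  have "\<exists>N>0. \<forall>n\<in>A. \<bar>n\<bar> < N"
    using assms
  proof (induction A)
    case empty
    show ?case by (rule exI[of _ 1]) simp
  next
    case (insert m A)
    then obtain N where "N > 0" "\<forall>n\<in>A. \<bar>n\<bar> < N"
      by blast
    then show ?case
      by (intro exI[of _ "N + \<bar>m\<bar> + 1"]) force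
  qed
  then show ?thesis
    using that by blast
qed

text \<open>The weight n(n + 1)/2 in (3) is chosen for this difference. The two products differ by 2
  n, so no rounding occurs in the integer divisions.\<close>

lemma triangular_step:
  fixes n :: int
  shows "(n - 1) * (n - 1 + 1) div 2 - n * (n + 1) div 2 = - n"
proof -
  have "n * (n + 1) = (n - 1) * (n - 1 + 1) + n * 2"
    by (simp add: algebra_simps)
  then show ?thesis
    by (simp only: div_mult_self1)
qed

locale elliptic_translation = elliptic_function_field E F
  for E :: "'c::alg_closed_field weierstrass" and F :: "('c, 'k::field) fun_field" +
  fixes s :: "'c point" and \<tau> :: "'k \<Rightarrow> 'k" and rep :: "'c point set \<Rightarrow> 'c point"
  assumes s_in [simp]: "s \<in> curve_points E"
    and non_torsion: "\<forall>n::nat. n > 0 \<longrightarrow> s [^]\<^bsub>curve_group E\<^esub> n \<noteq> \<one>\<^bsub>curve_group E\<^esub>"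
    and translation: "translation_automorphism E F s \<tau>"
    and rep: "\<forall>\<omega>\<in>orbits E s. rep \<omega> \<in> \<omega>"
begin

section \<open>Translation of functions and valuations\<close>

lemma tau_bij: "bij_betw \<tau> K K"
  and tau_mult: "f \<in> K \<Longrightarrow> g \<in> K \<Longrightarrow> \<tau> (f * g) = \<tau> f * \<tau> g"
  and tau_emb: "\<tau> (emb F c) = emb F c"
  and tau_value: "f \<in> K \<Longrightarrow> \<alpha> \<in> \<E> \<Longrightarrow> has_value F f (curve_add E \<alpha> s) c \<Longrightarrow> has_value F (\<tau> f) \<alpha> c"
  using translation by (auto simp: translation_automorphism_def)

lemma tau_0: "\<tau> 0 = 0" and tau_1: "\<tau> 1 = 1"
  using tau_emb[of 0] tau_emb[of 1] by simp_all

lemma tau_in_K [simp]: "f \<in> K \<Longrightarrow> \<tau> f \<in> K"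
  using tau_bij bij_betwE by blast

lemma tau_nonzero: "f \<in> K \<Longrightarrow> f \<noteq> 0 \<Longrightarrow> \<tau> f \<noteq> 0"
  using tau_bij tau_0 zero_in_K unfolding bij_betw_def inj_on_def by metis

lemma tau_inverse: "f \<in> K \<Longrightarrow> \<tau> (inverse f) = inverse (\<tau> f)"
proof (cases "f = 0")
  case False
  assume "f \<in> K"
  then have "\<tau> f * \<tau> (inverse f) = 1"
    using False tau_mult[of f "inverse f"] tau_1 by simp
  then show ?thesis
    by (simp add: inverse_unique)
qed (simp add: tau_0)

lemma tau_power: "f \<in> K \<Longrightarrow> \<tau> (f ^ n) = \<tau> f ^ n"
  by (induction n) (simp_all add: tau_1 tau_mult)

lemma tau_powi: "f \<in> K \<Longrightarrow> \<tau> (f powi n) = \<tau> f powi n"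
  by (simp add: power_int_def tau_power tau_inverse)

text \<open>By definition \<open>\<tau>\<close> transports only values. So a uniformizer at \<alpha>
  \<oplus> s is sent to a function of some order e > 0 at \<alpha>, and units are sent to units,
  which proves the claim up to the factor e. Since \<open>\<tau>\<close> is surjective, some image
  has order 1, so e divides 1.\<close>

lemma val_tau:
  assumes \<alpha>: "\<alpha> \<in> \<E>" and f: "f \<in> K" "f \<noteq> 0"
  shows "\<nu> \<alpha> (\<tau> f) = \<nu> (curve_add E \<alpha> s) f"
proof -
  let ?\<beta> = "curve_add E \<alpha> s"
  have \<beta>: "?\<beta> \<in> \<E>"
    using \<alpha> by (simp add: curve_add_closed)
  obtain t where t: "t \<in> K" "t \<noteq> 0" "has_value F t ?\<beta> 0"
    and dec: "\<And>f. f \<in> K \<Longrightarrow> f \<noteq> 0 \<Longrightarrow> \<exists>w c. has_value F w ?\<beta> c \<and> c \<noteq> 0 \<and> f = w * t powi \<nu> ?\<beta> f"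
    using val_decompose[OF \<beta>] by metis
  define e where "e = \<nu> \<alpha> (\<tau> t)"
  have "e > 0"
    unfolding e_def using t \<alpha> tau_value val_pos_iff[OF \<alpha>] tau_nonzero by simp
  have scale: "\<nu> \<alpha> (\<tau> f) = \<nu> ?\<beta> f * e" if f: "f \<in> K" "f \<noteq> 0" for f
  proof -
    obtain w c where w: "has_value F w ?\<beta> c" "c \<noteq> 0" "f = w * t powi \<nu> ?\<beta> f"
      using dec f by blast
    have wK: "w \<in> K" "w \<noteq> 0"
      using w(1) has_value_in_K w(3) f(2) by auto
    then have "\<tau> f = \<tau> w * \<tau> t powi \<nu> ?\<beta> f"
      by (subst w(3)) (simp add: tau_mult tau_powi t)
    moreover have "\<nu> \<alpha> (\<tau> w) = 0"
      using val_unit[OF \<alpha> tau_value[OF wK(1) \<alpha> w(1)] w(2)] .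
    ultimately show ?thesis
      unfolding e_def using wK t by (simp add: val_mult val_powi \<alpha> tau_nonzero)
  qed
  obtain t' where t': "t' \<in> K" "t' \<noteq> 0" "\<nu> \<alpha> t' = 1"
    using val_decompose[OF \<alpha>] by metis
  then obtain g where g: "g \<in> K" "t' = \<tau> g"
    using tau_bij unfolding bij_betw_def by blast
  then have "\<nu> ?\<beta> g * e = 1"
    using scale[of g] t' tau_0 by auto
  then have "e = 1"
    using \<open>e > 0\<close> zmult_eq_1_iff[of "\<nu> ?\<beta> g" e] by auto
  then show ?thesis
    using scale[OF f] by simp
qed

section \<open>Orbits of the translation\<close>

definition cyc :: "'c point set" where "cyc = range (\<lambda>n::int. s [^]\<^bsub>G\<^esub> n)"

lemma s_pow_in [simp]: "s [^]\<^bsub>G\<^esub> (n::int) \<in> \<E>"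
  using curve.int_pow_closed[of s n] by simp

lemma cyc_subgroup: "subgroup cyc G"
proof (rule curve.subgroupI)
  fix P Q
  assume "P \<in> cyc" "Q \<in> cyc"
  then obtain m n :: int where P: "P = s [^]\<^bsub>G\<^esub> m" and Q: "Q = s [^]\<^bsub>G\<^esub> n"
    by (auto simp: cyc_def)
  have "P \<otimes>\<^bsub>G\<^esub> Q = s [^]\<^bsub>G\<^esub> (m + n)"
    unfolding P Q using curve.int_pow_mult[of s m n] by simp
  then show "P \<otimes>\<^bsub>G\<^esub> Q \<in> cyc"
    unfolding cyc_def by blast
  have "inv\<^bsub>G\<^esub> P = s [^]\<^bsub>G\<^esub> (- m)"
    unfolding P using curve.int_pow_neg[of s m] by simp
  then show "inv\<^bsub>G\<^esub> P \<in> cyc"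
    unfolding cyc_def by blast
qed (auto simp: cyc_def)

lemma orbits_eq: "orbits E s = rcosets\<^bsub>G\<^esub> cyc"
  by (simp add: orbits_def cyc_def)

lemma coset_in_orbits: "P \<in> \<E> \<Longrightarrow> cyc #>\<^bsub>G\<^esub> P \<in> orbits E s"
  unfolding orbits_eq RCOSETS_def by auto

lemma self_in_coset: "P \<in> \<E> \<Longrightarrow> P \<in> cyc #>\<^bsub>G\<^esub> P"
  using curve.rcos_self[OF _ cyc_subgroup] by simp

lemma orbit_subset: "\<omega> \<in> orbits E s \<Longrightarrow> \<omega> \<subseteq> \<E>"
  using curve.rcosets_part_G[OF cyc_subgroup] unfolding orbits_eq by auto

lemma orbit_coset:
  assumes "\<omega> \<in> orbits E s" "P \<in> \<omega>"
  shows "\<omega> = cyc #>\<^bsub>G\<^esub> P"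
proof -
  obtain Q where "Q \<in> \<E>" "\<omega> = cyc #>\<^bsub>G\<^esub> Q"
    using assms(1) unfolding orbits_eq RCOSETS_def by auto
  then show ?thesis
    using curve.repr_independence[OF _ _ cyc_subgroup, of P Q] assms(2) by simp
qed

lemma rep_in: "\<omega> \<in> orbits E s \<Longrightarrow> rep \<omega> \<in> \<E>"
  using rep orbit_subset by blast

lemma shift_in: "P \<in> \<E> \<Longrightarrow> shift E s P n \<in> \<E>"
  by (simp add: shift_def curve_add_closed)

lemma shift_add:
  assumes "P \<in> \<E>"
  shows "shift E s P (n + 1) = curve_add E (shift E s P n) s"
proof -
  have "s [^]\<^bsub>G\<^esub> (n + 1) = curve_add E (s [^]\<^bsub>G\<^esub> n) s"
    using curve.int_pow_mult[of s n 1] curve.int_pow_1[of s] by simp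
  then show ?thesis
    using assms by (simp add: shift_def curve_add_assoc)
qed

lemma orbit_shift:
  assumes "\<omega> \<in> orbits E s"
  shows "\<omega> = range (shift E s (rep \<omega>))"
proof -
  have "\<omega> = cyc #>\<^bsub>G\<^esub> rep \<omega>"
    using orbit_coset assms rep by blast
  also have "\<dots> = range (shift E s (rep \<omega>))"
    unfolding r_coset_def cyc_def shift_def mult_G
    using curve_add_commute[OF s_pow_in rep_in[OF assms]] by auto
  finally show ?thesis .
qed

lemma shift_in_orbit: "\<omega> \<in> orbits E s \<Longrightarrow> shift E s (rep \<omega>) n \<in> \<omega>"
  using orbit_shift by blast

lemma s_pow_inj:
  assumes "s [^]\<^bsub>G\<^esub> (m::int) = s [^]\<^bsub>G\<^esub> n"
  shows "m = n"
proof (rule ccontr)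
  assume "m \<noteq> n"
  have *: False if "s [^]\<^bsub>G\<^esub> (m::int) = s [^]\<^bsub>G\<^esub> n" "m < n" for m n
  proof -
    have "s [^]\<^bsub>G\<^esub> (n - m) = \<one>\<^bsub>G\<^esub>"
      using curve.int_pow_diff[of s n m] curve.r_inv[of "s [^]\<^bsub>G\<^esub> n"] that(1) by simp
    moreover have "n - m = int (nat (n - m))"
      using that(2) by simp
    ultimately have "s [^]\<^bsub>G\<^esub> nat (n - m) = \<one>\<^bsub>G\<^esub>"
      by (metis int_pow_int)
    moreover have "nat (n - m) > 0"
      using that(2) by simp
    ultimately show False
      using non_torsion by blast
  qed
  then show False
    using *[of m n] *[of n m] assms \<open>m \<noteq> n\<close> by (cases m n rule: linorder_cases) auto
qed

lemma shift_inj: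
  assumes "P \<in> \<E>" "shift E s P m = shift E s P n"
  shows "m = n"
proof -
  have "s [^]\<^bsub>G\<^esub> m = s [^]\<^bsub>G\<^esub> n"
    using assms curve.Units_l_cancel[of P "s [^]\<^bsub>G\<^esub> m" "s [^]\<^bsub>G\<^esub> n"] by (simp add: shift_def)
  then show ?thesis
    by (rule s_pow_inj)
qed

text \<open>Coordinates on the curve by orbit and position. They are unique because \<open>s\<close>
  is non-torsion, and they turn divisors into families of integer sequences.\<close>

definition pt :: "'c point set \<times> int \<Rightarrow> 'c point"
  where "pt = (\<lambda>(\<omega>, n). shift E s (rep \<omega>) n)"

lemma pt_bij: "bij_betw pt (orbits E s \<times> UNIV) \<E>"
  unfolding bij_betw_def
proof
  show "inj_on pt (orbits E s \<times> UNIV)"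
  proof (rule inj_onI, clarify)
    fix \<omega> \<omega>' m n
    assume *: "\<omega> \<in> orbits E s" "\<omega>' \<in> orbits E s" "pt (\<omega>, m) = pt (\<omega>', n)"
    have "pt (\<omega>, m) \<in> \<omega>" "pt (\<omega>', n) \<in> \<omega>'"
      using shift_in_orbit *(1,2) unfolding pt_def by simp_all
    then have "\<omega> = \<omega>'"
      using orbit_coset[OF *(1)] orbit_coset[OF *(2)] *(3) by metis
    then show "\<omega> = \<omega>' \<and> m = n"
      using *(3) shift_inj[OF rep_in[OF *(2)]] unfolding pt_def by auto
  qed
  show "pt ` (orbits E s \<times> UNIV) = \<E>"
  proof
    show "\<E> \<subseteq> pt ` (orbits E s \<times> UNIV)"
    proof
      fix P
      assume "P \<in> \<E>"
      then have "P \<in> cyc #>\<^bsub>G\<^esub> P" "cyc #>\<^bsub>G\<^esub> P \<in> orbits E s"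
        using self_in_coset coset_in_orbits by auto
      then obtain n where "P = pt (cyc #>\<^bsub>G\<^esub> P, n)"
        using orbit_shift[of "cyc #>\<^bsub>G\<^esub> P"] unfolding pt_def prod.case by blast
      then show "P \<in> pt ` (orbits E s \<times> UNIV)"
        using \<open>cyc #>\<^bsub>G\<^esub> P \<in> orbits E s\<close> by blast
    qed
  qed (auto simp: pt_def shift_in rep_in)
qed

lemma pt_in: "\<omega> \<in> orbits E s \<Longrightarrow> pt (\<omega>, n) \<in> \<E>"
  by (simp add: pt_def shift_in rep_in)

lemma ptE:
  assumes "P \<in> \<E>"
  obtains \<omega> n where "\<omega> \<in> orbits E s" "P = pt (\<omega>, n)"
proof -
  obtain z where "z \<in> orbits E s \<times> UNIV" "P = pt z"
    using bij_betw_imp_surj_on[OF pt_bij] assms by blast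
  then show ?thesis
    using that by (cases z) auto
qed

lemma pt_inj: "inj_on pt (orbits E s \<times> UNIV)"
  using pt_bij by (rule bij_betw_imp_inj_on)

lemma pt_Suc: "\<omega> \<in> orbits E s \<Longrightarrow> pt (\<omega>, n + 1) = curve_add E (pt (\<omega>, n)) s"
  by (simp add: pt_def shift_add rep_in)

text \<open>The strict bound on n leaves a margin: both D and its translate by one step vanish
  outside the positions from - N to N.\<close>

lemma finite_support_box:
  assumes "finite {P \<in> \<E>. D P \<noteq> (0::int)}"
  obtains \<Omega> N where "finite \<Omega>" "\<Omega> \<subseteq> orbits E s" "N > 0"
    "\<And>\<omega> n. \<omega> \<in> orbits E s \<Longrightarrow> D (pt (\<omega>, n)) \<noteq> 0 \<Longrightarrow> \<omega> \<in> \<Omega> \<and> \<bar>n\<bar> < N"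
proof -
  define A where "A = {z \<in> orbits E s \<times> UNIV. D (pt z) \<noteq> 0}"
  have "pt ` A \<subseteq> {P \<in> \<E>. D P \<noteq> 0}"
    using pt_bij unfolding A_def bij_betw_def by blast
  moreover have "inj_on pt A"
    using pt_inj unfolding A_def by (rule inj_on_subset) blast
  ultimately have A: "finite A"
    using finite_imageD[OF finite_subset[OF _ assms]] by blast
  obtain N where N: "N > 0" "\<And>n. n \<in> snd ` A \<Longrightarrow> \<bar>n\<bar> < N"
    using finite_int_bounded[OF finite_imageI[OF A]] by blast
  have "finite (fst ` A)" "fst ` A \<subseteq> orbits E s"
    using A by (auto simp: A_def)
  moreover have "\<omega> \<in> fst ` A \<and> \<bar>n\<bar> < N" if "\<omega> \<in> orbits E s" "D (pt (\<omega>, n)) \<noteq> 0" for \<omega> n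
  proof -
    have "(\<omega>, n) \<in> A"
      using that by (simp add: A_def)
    then show ?thesis
      using N(2) by force
  qed
  ultimately show ?thesis
    by (rule that[OF _ _ N(1)])
qed

text \<open>The relation between the divisors of \<open>c * (\<tau> r / r)\<close> and of \<open>r\<close>.\<close>

definition shift_difference :: "('c point \<Rightarrow> int) \<Rightarrow> ('c point \<Rightarrow> int) \<Rightarrow> bool"
  where "shift_difference b D \<longleftrightarrow> finite {P \<in> \<E>. D P \<noteq> 0} \<and> (\<forall>P\<in>\<E>. b P = D (curve_add E P s) - D P)"

section \<open>The difference equation on divisors\<close>

lemma finite_support_val:
  assumes "f \<in> K" "f \<noteq> 0"
  shows "finite {P \<in> \<E>. \<nu> P f \<noteq> 0}"
proof -
  obtain S where "finite S" "\<And>P. P \<in> \<E> - S \<Longrightarrow> \<nu> P f = 0"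
    using degree_divisor[OF assms] by metis
  then show ?thesis
    by (elim finite_subset[rotated]) auto
qed

lemma tau_quotient_iff:
  assumes a: "a \<in> K" "a \<noteq> 0"
  shows "(\<exists>r\<in>K. \<exists>c. r \<noteq> 0 \<and> c \<noteq> 0 \<and> a = emb F c * (\<tau> r / r)) \<longleftrightarrow>
    (\<exists>D. shift_difference (\<lambda>P. \<nu> P a) D \<and> principal D)"
proof
  assume "\<exists>r\<in>K. \<exists>c. r \<noteq> 0 \<and> c \<noteq> 0 \<and> a = emb F c * (\<tau> r / r)"
  then obtain r c where r: "r \<in> K" "r \<noteq> 0" "c \<noteq> 0" "a = emb F c * (\<tau> r / r)"
    by blast
  have "\<nu> P a = \<nu> (curve_add E P s) r - \<nu> P r" if "P \<in> \<E>" for P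
    using that r tau_nonzero[OF r(1,2)]
    by (simp add: val_mult val_divide val_emb val_tau)
  then have "shift_difference (\<lambda>P. \<nu> P a) (\<lambda>P. \<nu> P r)"
    unfolding shift_difference_def using finite_support_val r by auto
  moreover have "principal (\<lambda>P. \<nu> P r)"
    using principalI r by auto
  ultimately show "\<exists>D. shift_difference (\<lambda>P. \<nu> P a) D \<and> principal D"
    by blast
next
  assume "\<exists>D. shift_difference (\<lambda>P. \<nu> P a) D \<and> principal D"
  then obtain D r where D: "\<And>P. P \<in> \<E> \<Longrightarrow> \<nu> P a = D (curve_add E P s) - D P"
    and r: "r \<in> K" "r \<noteq> 0" "\<And>P. P \<in> \<E> \<Longrightarrow> \<nu> P r = D P"
    unfolding shift_difference_def principal_def by auto
  \<comment> \<open>The difference equation makes every valuation of this function zero, so it is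
    the required constant.\<close>
  let ?f = "a * r / \<tau> r"
  have \<tau>r: "\<tau> r \<noteq> 0"
    using tau_nonzero r by simp
  have "\<nu> P ?f = 0" if P: "P \<in> \<E>" for P
    using P a r \<tau>r D[OF P] curve_add_closed[OF P s_in]
    by (simp add: val_mult val_divide val_tau)
  then obtain c where "c \<noteq> 0" "?f = emb F c"
    using no_zeros_constant[of ?f] a r \<tau>r by auto
  then have "a = emb F c * (\<tau> r / r)"
    using r \<tau>r by (simp add: field_simps)
  then show "\<exists>r\<in>K. \<exists>c. r \<noteq> 0 \<and> c \<noteq> 0 \<and> a = emb F c * (\<tau> r / r)"
    using r \<open>c \<noteq> 0\<close> by blast
qed

lemma sum'_orbit:
  assumes "\<omega> \<in> orbits E s"
    and "\<And>n. b (pt (\<omega>, n)) \<noteq> (0::int) \<Longrightarrow> \<bar>n\<bar> \<le> N"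
  shows "sum' b \<omega> = (\<Sum>n\<in>{- N..N}. b (pt (\<omega>, n)))"
proof -
  have inj: "inj (shift E s (rep \<omega>))"
    using shift_inj[OF rep_in[OF assms(1)]] by (rule injI)
  have "sum' b \<omega> = sum b (shift E s (rep \<omega>) ` {- N..N})"
  proof (rule sum'_eq_sum)
    show "shift E s (rep \<omega>) ` {- N..N} \<subseteq> \<omega>"
      using orbit_shift[OF assms(1)] by blast
    fix P
    assume P: "P \<in> \<omega> - shift E s (rep \<omega>) ` {- N..N}"
    then obtain n where "P = shift E s (rep \<omega>) n"
      using orbit_shift[OF assms(1)] by blast
    then have "\<not> \<bar>n\<bar> \<le> N"
      using P by (auto simp: abs_le_iff)
    then show "b P = 0"
      using \<open>P = _\<close> assms(2)[of n] by (auto simp: pt_def)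
  qed simp
  also have "\<dots> = (\<Sum>n\<in>{- N..N}. b (pt (\<omega>, n)))"
    using inj by (subst sum.reindex) (auto simp: pt_def intro: inj_on_subset)
  finally show ?thesis .
qed

text \<open>On each orbit D is the sequence of partial sums of b. It vanishes to the left of the
  support of b, and to the right because there it equals the full orbit sum.\<close>

lemma shift_difference_exists:
  assumes fin: "finite {P \<in> \<E>. b P \<noteq> 0}" and sum0: "\<And>\<omega>. \<omega> \<in> orbits E s \<Longrightarrow> sum' b \<omega> = 0"
  obtains D where "shift_difference b D"
proof -
  obtain \<Omega> N where box: "finite \<Omega>" "\<Omega> \<subseteq> orbits E s" "N > 0"
    "\<And>\<omega> n. \<omega> \<in> orbits E s \<Longrightarrow> b (pt (\<omega>, n)) \<noteq> 0 \<Longrightarrow> \<omega> \<in> \<Omega> \<and> \<bar>n\<bar> < N"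
    using finite_support_box[OF fin] by blast
  \<comment> \<open>Position n itself is left out, so that g(n + 1) - g(n) is the value of b at n.
    The start - N lies below the support.\<close>
  define g where "g = (\<lambda>(\<omega>, n). \<Sum>m\<in>{- N..<n}. b (pt (\<omega>, m)))"
  \<comment> \<open>Off the curve the inverse is unspecified; \<open>shift_difference\<close> looks
    only at points of the curve.\<close>
  define D where "D = g \<circ> the_inv_into (orbits E s \<times> UNIV) pt"
  have D: "D (pt (\<omega>, n)) = g (\<omega>, n)" if "\<omega> \<in> orbits E s" for \<omega> n
    unfolding D_def using the_inv_into_f_f[OF pt_inj] that by simp
  have g0: "\<omega> \<in> \<Omega> \<and> n \<in> {- N..N}" if \<omega>: "\<omega> \<in> orbits E s" and g: "g (\<omega>, n) \<noteq> 0" for \<omega> n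
  proof -
    obtain m where "m \<in> {- N..<n}" "b (pt (\<omega>, m)) \<noteq> 0"
      using g unfolding g_def by (auto elim: sum.not_neutral_contains_not_neutral)
    then have "\<omega> \<in> \<Omega>" "n > - N"
      using box(4) \<omega> by auto
    have far: "b (pt (\<omega>, m)) = 0" if "\<not> m \<le> N" for m
      using box(4)[OF \<omega>, of m] that by force
    have "n \<le> N"
    proof (rule ccontr)
      assume "\<not> n \<le> N"
      have "g (\<omega>, n) = (\<Sum>m\<in>{- N..N}. b (pt (\<omega>, m)))"
        unfolding g_def prod.case using \<open>\<not> n \<le> N\<close>
        by (intro sum.mono_neutral_right) (auto intro!: far)
      also have "\<dots> = sum' b \<omega>"
        using sum'_orbit[OF \<omega>, of b N] box(4)[OF \<omega>] by fastforce
      finally show False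
        using sum0[OF \<omega>] g by simp
    qed
    with \<open>\<omega> \<in> \<Omega>\<close> \<open>n > - N\<close> show ?thesis
      by simp
  qed
  have "{P \<in> \<E>. D P \<noteq> 0} \<subseteq> pt ` (\<Omega> \<times> {- N..N})"
  proof clarify
    fix P
    assume P: "P \<in> \<E>" "D P \<noteq> 0"
    then obtain \<omega> n where "\<omega> \<in> orbits E s" "P = pt (\<omega>, n)"
      using ptE by blast
    then show "P \<in> pt ` (\<Omega> \<times> {- N..N})"
      using g0[of \<omega> n] D[of \<omega> n] P(2) by auto
  qed
  then have "finite {P \<in> \<E>. D P \<noteq> 0}"
    using box(1) finite_subset by blast
  moreover have "b P = D (curve_add E P s) - D P" if "P \<in> \<E>" for P
  proof -
    obtain \<omega> n where \<omega>: "\<omega> \<in> orbits E s" and P: "P = pt (\<omega>, n)"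
      using ptE \<open>P \<in> \<E>\<close> by blast
    have "D (curve_add E P s) - D P = g (\<omega>, n + 1) - g (\<omega>, n)"
      unfolding P using D[OF \<omega>] pt_Suc[OF \<omega>] by metis
    also have "\<dots> = b P"
    proof (cases "n \<ge> - N")
      case True
      then have "{- N..<n + 1} = insert n {- N..<n}"
        by auto
      then show ?thesis
        by (simp add: g_def P)
    next
      case False
      then have "b (pt (\<omega>, n)) = 0"
        using box(4)[OF \<omega>, of n] by (cases "b (pt (\<omega>, n)) = 0") auto
      then show ?thesis
        using False by (simp add: g_def P)
    qed
    finally show ?thesis
      by simp
  qed
  ultimately show ?thesis
    using that unfolding shift_difference_def by blast
qed

text \<open>Summation by parts turns the weights 1, n and n(n + 1)/2 on b into 0, -1 and -n on D. So
  the sum in (2) is minus the degree of D. As D is supported on points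
  \<open>rep \<omega> \<oplus> n s\<close>, the combination in (3) is the inverse of its group sum,
  and \<open>principal_iff\<close> applies.\<close>

lemma shift_difference_conditions:
  assumes "shift_difference b D"
  shows "\<forall>\<omega>\<in>orbits E s. sum' b \<omega> = 0"
    and "principal D \<longleftrightarrow>
      sum' (\<lambda>\<omega>. sum' (\<lambda>n::int. n * b (shift E s (rep \<omega>) n)) UNIV) (orbits E s) = 0 \<and>
      gfinprod G (\<lambda>\<omega>. gfinprod G (\<lambda>n::int. rep \<omega> [^]\<^bsub>G\<^esub> (n * b (shift E s (rep \<omega>) n))) UNIV)
        (orbits E s) \<otimes>\<^bsub>G\<^esub>
      gfinprod G (\<lambda>\<omega>. gfinprod G (\<lambda>n::int. s [^]\<^bsub>G\<^esub> (n * (n + 1) div 2 * b (shift E s (rep \<omega>) n))) UNIV)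
        (orbits E s) = \<one>\<^bsub>G\<^esub>" (is "_ \<longleftrightarrow> ?deg = 0 \<and> ?X \<otimes>\<^bsub>G\<^esub> ?Y = \<one>\<^bsub>G\<^esub>")
proof -
  have fin: "finite {P \<in> \<E>. D P \<noteq> 0}" and bD: "\<And>P. P \<in> \<E> \<Longrightarrow> b P = D (curve_add E P s) - D P"
    using assms by (auto simp: shift_difference_def)
  obtain \<Omega> N where box: "finite \<Omega>" "\<Omega> \<subseteq> orbits E s" "N > 0"
    "\<And>\<omega> n. \<omega> \<in> orbits E s \<Longrightarrow> D (pt (\<omega>, n)) \<noteq> 0 \<Longrightarrow> \<omega> \<in> \<Omega> \<and> \<bar>n\<bar> < N"
    using finite_support_box[OF fin] by blast
  let ?I = "{- N..N}"
  define g where "g \<omega> n = D (pt (\<omega>, n))" for \<omega> n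
  have b: "b (pt (\<omega>, n)) = g \<omega> (n + 1) - g \<omega> n" if "\<omega> \<in> orbits E s" for \<omega> n
    using bD[OF pt_in] pt_Suc that by (simp add: g_def)
  have b': "b (shift E s (rep \<omega>) n) = g \<omega> (n + 1) - g \<omega> n" if "\<omega> \<in> orbits E s" for \<omega> n
    using b[OF that] by (simp add: pt_def)
  have g0: "g \<omega> n = 0" if "\<omega> \<in> orbits E s" "\<omega> \<notin> \<Omega> \<or> \<bar>n\<bar> \<ge> N" for \<omega> n
    using box(4)[OF that(1), of n] that(2) unfolding g_def by (meson not_le)
  have b0: "g \<omega> (n + 1) - g \<omega> n = 0" if "\<omega> \<in> orbits E s" "\<omega> \<notin> \<Omega> \<or> n \<notin> ?I" for \<omega> n
    using g0[OF that(1), of n] g0[OF that(1), of "n + 1"] that(2) box(3) by fastforce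
  have parts: "(\<Sum>n\<in>?I. w n * (g \<omega> (n + 1) - g \<omega> n)) = (\<Sum>n\<in>?I. (w (n - 1) - w n) * g \<omega> n)"
    if "\<omega> \<in> orbits E s" for \<omega> w
    using g0[OF that] box(3) by (intro sum_weighted_difference) auto
  show "\<forall>\<omega>\<in>orbits E s. sum' b \<omega> = 0"
  proof
    fix \<omega>
    assume \<omega>: "\<omega> \<in> orbits E s"
    have "\<bar>n\<bar> \<le> N" if "b (pt (\<omega>, n)) \<noteq> 0" for n
    proof (rule ccontr)
      assume "\<not> \<bar>n\<bar> \<le> N"
      then have "n \<notin> ?I"
        by auto
      then show False
        using b0[OF \<omega>, of n] b[OF \<omega>, of n] that by simp
    qed
    then have "sum' b \<omega> = (\<Sum>n\<in>?I. b (pt (\<omega>, n)))"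
      by (rule sum'_orbit[OF \<omega>])
    also have "\<dots> = 0"
      using parts[OF \<omega>, of "\<lambda>_. 1"] b[OF \<omega>] by simp
    finally show "sum' b \<omega> = 0" .
  qed
  have "?deg = (\<Sum>\<omega>\<in>\<Omega>. \<Sum>n\<in>?I. n * (g \<omega> (n + 1) - g \<omega> n))"
  proof -
    have inner: "sum' (\<lambda>n. n * b (shift E s (rep \<omega>) n)) UNIV = (\<Sum>n\<in>?I. n * (g \<omega> (n + 1) - g \<omega> n))"
      if "\<omega> \<in> orbits E s" for \<omega>
      unfolding b'[OF that] using b0[OF that] by (intro sum'_eq_sum) auto
    have "?deg = (\<Sum>\<omega>\<in>\<Omega>. sum' (\<lambda>n. n * b (shift E s (rep \<omega>) n)) UNIV)"
      using box(1,2) inner b0 by (intro sum'_eq_sum) auto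
    then show ?thesis
      using inner box(2) by (simp add: subset_iff)
  qed
  also have "\<dots> = (\<Sum>\<omega>\<in>\<Omega>. - (\<Sum>n\<in>?I. g \<omega> n))"
    using parts[of _ "\<lambda>n. n"] box(2) by (intro sum.cong) (auto simp: sum_negf subset_iff)
  finally have deg: "?deg = - (\<Sum>\<omega>\<in>\<Omega>. \<Sum>n\<in>?I. g \<omega> n)"
    by (simp add: sum_negf)
  \<comment> \<open>Serves both parts of (3): p = \<open>rep\<close> with weight n, and p constantly
    \<open>s\<close> with weight n(n + 1)/2.\<close>
  have gprod: "gfinprod G (\<lambda>\<omega>. gfinprod G (\<lambda>n. p \<omega> [^]\<^bsub>G\<^esub> (w n * b (shift E s (rep \<omega>) n))) UNIV) (orbits E s)
    = (\<Otimes>\<^bsub>G\<^esub>\<omega>\<in>\<Omega>. p \<omega> [^]\<^bsub>G\<^esub> (\<Sum>n\<in>?I. (w (n - 1) - w n) * g \<omega> n))"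
    if p: "\<And>\<omega>. \<omega> \<in> orbits E s \<Longrightarrow> p \<omega> \<in> \<E>" for p and w :: "int \<Rightarrow> int"
  proof -
    have inner: "gfinprod G (\<lambda>n. p \<omega> [^]\<^bsub>G\<^esub> (w n * b (shift E s (rep \<omega>) n))) UNIV
      = p \<omega> [^]\<^bsub>G\<^esub> (\<Sum>n\<in>?I. (w (n - 1) - w n) * g \<omega> n)" if \<omega>: "\<omega> \<in> orbits E s" for \<omega>
    proof -
      have "gfinprod G (\<lambda>n. p \<omega> [^]\<^bsub>G\<^esub> (w n * b (shift E s (rep \<omega>) n))) UNIV
        = (\<Otimes>\<^bsub>G\<^esub>n\<in>?I. p \<omega> [^]\<^bsub>G\<^esub> (w n * (g \<omega> (n + 1) - g \<omega> n)))"
        unfolding b'[OF \<omega>] using b0[OF \<omega>] p[OF \<omega>] curve.int_pow_closed[of "p \<omega>"]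
        by (intro curve.gfinprod_eq_finprod_subset) auto
      also have "\<dots> = p \<omega> [^]\<^bsub>G\<^esub> (\<Sum>n\<in>?I. w n * (g \<omega> (n + 1) - g \<omega> n))"
        using p[OF \<omega>] by (intro curve.finprod_int_pow) auto
      finally show ?thesis
        unfolding parts[OF \<omega>] .
    qed
    have "gfinprod G (\<lambda>\<omega>. gfinprod G (\<lambda>n. p \<omega> [^]\<^bsub>G\<^esub> (w n * b (shift E s (rep \<omega>) n))) UNIV) (orbits E s)
      = (\<Otimes>\<^bsub>G\<^esub>\<omega>\<in>\<Omega>. gfinprod G (\<lambda>n. p \<omega> [^]\<^bsub>G\<^esub> (w n * b (shift E s (rep \<omega>) n))) UNIV)"
      using box(1,2) inner g0 p curve.int_pow_closed[of "p _"]
      by (intro curve.gfinprod_eq_finprod_subset) auto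
    also have "\<dots> = (\<Otimes>\<^bsub>G\<^esub>\<omega>\<in>\<Omega>. p \<omega> [^]\<^bsub>G\<^esub> (\<Sum>n\<in>?I. (w (n - 1) - w n) * g \<omega> n))"
      using inner box(2) p curve.int_pow_closed[of "p _"] by (intro curve.finprod_cong') auto
    finally show ?thesis .
  qed
  let ?r = "\<lambda>\<omega>. rep \<omega> [^]\<^bsub>G\<^esub> (\<Sum>n\<in>?I. g \<omega> n)" and ?s = "\<lambda>\<omega>. s [^]\<^bsub>G\<^esub> (\<Sum>n\<in>?I. n * g \<omega> n)"
  have closed: "rep \<omega> [^]\<^bsub>G\<^esub> (k::int) \<in> carrier G" "s [^]\<^bsub>G\<^esub> (k::int) \<in> carrier G"
    if "\<omega> \<in> \<Omega>" for \<omega> k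
    using that box(2) rep_in curve.int_pow_closed by auto
  have rep_carrier: "rep \<omega> \<in> carrier G" if "\<omega> \<in> \<Omega>" for \<omega>
    using that box(2) rep_in by auto
  have X: "?X = (\<Otimes>\<^bsub>G\<^esub>\<omega>\<in>\<Omega>. inv\<^bsub>G\<^esub> ?r \<omega>)"
  proof -
    have "?X = (\<Otimes>\<^bsub>G\<^esub>\<omega>\<in>\<Omega>. rep \<omega> [^]\<^bsub>G\<^esub> (- (\<Sum>n\<in>?I. g \<omega> n)))"
      using gprod[of rep "\<lambda>n. n"] rep_in by (simp add: sum_negf)
    also have "\<dots> = (\<Otimes>\<^bsub>G\<^esub>\<omega>\<in>\<Omega>. inv\<^bsub>G\<^esub> ?r \<omega>)"
      using closed rep_carrier
      by (intro curve.finprod_cong') (auto simp: curve.int_pow_neg simp del: carrier_G)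
    finally show ?thesis .
  qed
  have Y: "?Y = (\<Otimes>\<^bsub>G\<^esub>\<omega>\<in>\<Omega>. inv\<^bsub>G\<^esub> ?s \<omega>)"
  proof -
    have s_neg: "s [^]\<^bsub>G\<^esub> (- k) = inv\<^bsub>G\<^esub> (s [^]\<^bsub>G\<^esub> k)" for k :: int
      by (rule curve.int_pow_neg) simp
    have "?Y = (\<Otimes>\<^bsub>G\<^esub>\<omega>\<in>\<Omega>. s [^]\<^bsub>G\<^esub> (- (\<Sum>n\<in>?I. n * g \<omega> n)))"
      using gprod[of "\<lambda>_. s" "\<lambda>n. n * (n + 1) div 2"] unfolding triangular_step
      by (simp add: sum_negf)
    also have "\<dots> = (\<Otimes>\<^bsub>G\<^esub>\<omega>\<in>\<Omega>. inv\<^bsub>G\<^esub> ?s \<omega>)"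
      using closed s_neg
      by (intro curve.finprod_cong') (auto simp del: carrier_G)
    finally show ?thesis .
  qed
  define T where "T = pt ` (\<Omega> \<times> ?I)"
  have inj: "inj_on pt (\<Omega> \<times> ?I)"
    using pt_inj by (rule inj_on_subset) (use box(2) in auto)
  have T: "finite T" "T \<subseteq> \<E>"
    unfolding T_def using box(1,2) pt_in by auto
  have D0: "D P = 0" if P: "P \<in> \<E> - T" for P
  proof (rule ccontr)
    assume "D P \<noteq> 0"
    obtain \<omega> n where \<omega>: "\<omega> \<in> orbits E s" "P = pt (\<omega>, n)"
      using ptE P by blast
    then have "(\<omega>, n) \<in> \<Omega> \<times> ?I"
      using \<open>D P \<noteq> 0\<close> box(4)[of \<omega> n] by auto
    then show False
      using P \<omega>(2) unfolding T_def by blast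
  qed
  have sumT: "sum D T = (\<Sum>\<omega>\<in>\<Omega>. \<Sum>n\<in>?I. g \<omega> n)"
    unfolding T_def sum.reindex[OF inj] sum.cartesian_product by (simp add: g_def case_prod_unfold)
  have "(\<Otimes>\<^bsub>G\<^esub>P\<in>T. P [^]\<^bsub>G\<^esub> D P) = (\<Otimes>\<^bsub>G\<^esub>\<omega>\<in>\<Omega>. \<Otimes>\<^bsub>G\<^esub>P\<in>(\<lambda>n. pt (\<omega>, n)) ` ?I. P [^]\<^bsub>G\<^esub> D P)"
  proof -
    have "T = (\<Union>\<omega>\<in>\<Omega>. (\<lambda>n. pt (\<omega>, n)) ` ?I)"
      unfolding T_def by auto
    moreover have "pairwise (\<lambda>\<omega> \<omega>'. disjnt ((\<lambda>n. pt (\<omega>, n)) ` ?I) ((\<lambda>n. pt (\<omega>', n)) ` ?I)) \<Omega>"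
      unfolding pairwise_def disjnt_def using inj_onD[OF inj] by fastforce
    ultimately show ?thesis
      using box(1,2) pt_in curve.int_pow_closed
      by (simp only:) (intro curve.finprod_UN_disjoint, auto)
  qed
  also have "\<dots> = (\<Otimes>\<^bsub>G\<^esub>\<omega>\<in>\<Omega>. ?r \<omega> \<otimes>\<^bsub>G\<^esub> ?s \<omega>)"
  proof (rule curve.finprod_cong')
    fix \<omega>
    assume \<omega>: "\<omega> \<in> \<Omega>"
    then have \<omega>': "\<omega> \<in> orbits E s"
      using box(2) by blast
    have "inj_on (\<lambda>n. pt (\<omega>, n)) ?I"
      using inj \<omega> unfolding inj_on_def by blast
    then have "(\<Otimes>\<^bsub>G\<^esub>P\<in>(\<lambda>n. pt (\<omega>, n)) ` ?I. P [^]\<^bsub>G\<^esub> D P) = (\<Otimes>\<^bsub>G\<^esub>n\<in>?I. pt (\<omega>, n) [^]\<^bsub>G\<^esub> g \<omega> n)"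
      unfolding g_def using pt_in[OF \<omega>'] curve.int_pow_closed
      by (intro curve.finprod_reindex) auto
    also have "\<dots> = (\<Otimes>\<^bsub>G\<^esub>n\<in>?I. rep \<omega> [^]\<^bsub>G\<^esub> g \<omega> n \<otimes>\<^bsub>G\<^esub> s [^]\<^bsub>G\<^esub> (n * g \<omega> n))"
    proof (rule curve.finprod_cong')
      fix n
      have "pt (\<omega>, n) [^]\<^bsub>G\<^esub> g \<omega> n = (rep \<omega> \<otimes>\<^bsub>G\<^esub> s [^]\<^bsub>G\<^esub> n) [^]\<^bsub>G\<^esub> g \<omega> n"
        by (simp add: pt_def shift_def)
      also have "\<dots> = rep \<omega> [^]\<^bsub>G\<^esub> g \<omega> n \<otimes>\<^bsub>G\<^esub> (s [^]\<^bsub>G\<^esub> n) [^]\<^bsub>G\<^esub> g \<omega> n"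
        using rep_in[OF \<omega>'] by (intro curve.int_pow_distrib) auto
      also have "(s [^]\<^bsub>G\<^esub> n) [^]\<^bsub>G\<^esub> g \<omega> n = s [^]\<^bsub>G\<^esub> (n * g \<omega> n)"
        by (intro curve.int_pow_pow) auto
      finally show "pt (\<omega>, n) [^]\<^bsub>G\<^esub> g \<omega> n = rep \<omega> [^]\<^bsub>G\<^esub> g \<omega> n \<otimes>\<^bsub>G\<^esub> s [^]\<^bsub>G\<^esub> (n * g \<omega> n)" .
    qed (use closed[OF \<omega>] in \<open>auto simp del: mult_G carrier_G\<close>)
    also have "\<dots> = (\<Otimes>\<^bsub>G\<^esub>n\<in>?I. rep \<omega> [^]\<^bsub>G\<^esub> g \<omega> n) \<otimes>\<^bsub>G\<^esub> (\<Otimes>\<^bsub>G\<^esub>n\<in>?I. s [^]\<^bsub>G\<^esub> (n * g \<omega> n))"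
      using closed[OF \<omega>] by (intro curve.finprod_multf) auto
    also have "\<dots> = ?r \<omega> \<otimes>\<^bsub>G\<^esub> ?s \<omega>"
      using rep_in[OF \<omega>'] curve.finprod_int_pow[of "rep \<omega>" ?I "g \<omega>"]
        curve.finprod_int_pow[of s ?I "\<lambda>n. n * g \<omega> n"] by simp
    finally show "(\<Otimes>\<^bsub>G\<^esub>P\<in>(\<lambda>n. pt (\<omega>, n)) ` ?I. P [^]\<^bsub>G\<^esub> D P) = ?r \<omega> \<otimes>\<^bsub>G\<^esub> ?s \<omega>" .
  qed (use closed in \<open>auto simp del: mult_G carrier_G\<close>)
  finally have prodT: "(\<Otimes>\<^bsub>G\<^esub>P\<in>T. P [^]\<^bsub>G\<^esub> D P) = (\<Otimes>\<^bsub>G\<^esub>\<omega>\<in>\<Omega>. ?r \<omega> \<otimes>\<^bsub>G\<^esub> ?s \<omega>)" (is "_ = ?Z") .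
  have Z: "?Z \<in> carrier G"
    using closed by (intro curve.finprod_closed) (auto simp del: mult_G carrier_G)
  have "?X \<otimes>\<^bsub>G\<^esub> ?Y = (\<Otimes>\<^bsub>G\<^esub>\<omega>\<in>\<Omega>. inv\<^bsub>G\<^esub> ?r \<omega> \<otimes>\<^bsub>G\<^esub> inv\<^bsub>G\<^esub> ?s \<omega>)"
    unfolding X Y using closed by (intro curve.finprod_multf[symmetric]) (auto simp del: carrier_G)
  also have "\<dots> = (\<Otimes>\<^bsub>G\<^esub>\<omega>\<in>\<Omega>. inv\<^bsub>G\<^esub> (?r \<omega> \<otimes>\<^bsub>G\<^esub> ?s \<omega>))"
    using closed by (intro curve.finprod_cong')
      (auto simp: curve.inv_mult simp del: mult_G carrier_G)
  finally have XY: "?X \<otimes>\<^bsub>G\<^esub> ?Y = (\<Otimes>\<^bsub>G\<^esub>\<omega>\<in>\<Omega>. inv\<^bsub>G\<^esub> (?r \<omega> \<otimes>\<^bsub>G\<^esub> ?s \<omega>))" .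
  \<comment> \<open>The left side of (3) and the group sum \<open>?Z\<close> of D are inverse to
    each other, so one is neutral exactly if the other is.\<close>
  have "(?X \<otimes>\<^bsub>G\<^esub> ?Y) \<otimes>\<^bsub>G\<^esub> ?Z = (\<Otimes>\<^bsub>G\<^esub>\<omega>\<in>\<Omega>. inv\<^bsub>G\<^esub> (?r \<omega> \<otimes>\<^bsub>G\<^esub> ?s \<omega>) \<otimes>\<^bsub>G\<^esub> (?r \<omega> \<otimes>\<^bsub>G\<^esub> ?s \<omega>))"
    unfolding XY using closed
    by (intro curve.finprod_multf[symmetric]) (auto simp del: mult_G carrier_G)
  also have "\<dots> = \<one>\<^bsub>G\<^esub>"
    using closed by (intro curve.finprod_one_eqI curve.l_inv curve.m_closed)
  finally have XYZ: "(?X \<otimes>\<^bsub>G\<^esub> ?Y) \<otimes>\<^bsub>G\<^esub> ?Z = \<one>\<^bsub>G\<^esub>" .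
  have XYc: "?X \<otimes>\<^bsub>G\<^esub> ?Y \<in> carrier G"
    unfolding XY using closed
    by (intro curve.finprod_closed) (auto simp del: mult_G carrier_G)
  have one: "p = \<one>\<^bsub>G\<^esub> \<longleftrightarrow> q = \<one>\<^bsub>G\<^esub>"
    if "p \<otimes>\<^bsub>G\<^esub> q = \<one>\<^bsub>G\<^esub>" "p \<in> carrier G" "q \<in> carrier G" for p q
    using that by (metis curve.l_one curve.r_one)
  have "principal D \<longleftrightarrow> ?deg = 0 \<and> ?Z = \<one>\<^bsub>G\<^esub>"
    using principal_iff[OF T, of D, OF D0] unfolding deg sumT prodT one_G neg_equal_0_iff_equal .
  then show "principal D \<longleftrightarrow> ?deg = 0 \<and> ?X \<otimes>\<^bsub>G\<^esub> ?Y = \<one>\<^bsub>G\<^esub>"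
    unfolding one[OF XYZ XYc Z] .
qed

end

theorem theorem5p15:
  fixes E :: "'c::alg_closed_field weierstrass"
    and F :: "('c, 'k::field) fun_field"
    and s :: "'c point"
    and \<tau> :: "'k \<Rightarrow> 'k"
    and rep :: "'c point set \<Rightarrow> 'c point"
    and a :: 'k
  assumes "elliptic_curve E"
    and "is_function_field E F"
    and "s \<in> curve_points E"
    and "\<forall>n::nat. n > 0 \<longrightarrow> s [^]\<^bsub>curve_group E\<^esub> n \<noteq> \<one>\<^bsub>curve_group E\<^esub>"
    and "translation_automorphism E F s \<tau>"
    and "\<forall>\<omega>\<in>orbits E s. rep \<omega> \<in> \<omega>"
    and "a \<in> ff_carrier F" and "a \<noteq> 0"
  shows "(\<exists>r\<in>ff_carrier F. \<exists>c. r \<noteq> 0 \<and> c \<noteq> 0 \<and> a = emb F c * (\<tau> r / r)) \<longleftrightarrow>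
    (\<forall>\<omega>\<in>orbits E s. sum' (\<lambda>\<alpha>. valuation F \<alpha> a) \<omega> = 0) \<and>
    sum' (\<lambda>\<omega>. sum' (\<lambda>n::int. n * valuation F (shift E s (rep \<omega>) n) a) UNIV) (orbits E s) = 0 \<and>
    gfinprod (curve_group E)
      (\<lambda>\<omega>. gfinprod (curve_group E)
        (\<lambda>n::int. rep \<omega> [^]\<^bsub>curve_group E\<^esub>
          (n * valuation F (shift E s (rep \<omega>) n) a)) UNIV) (orbits E s)
    \<otimes>\<^bsub>curve_group E\<^esub>
    gfinprod (curve_group E)
      (\<lambda>\<omega>. gfinprod (curve_group E)
        (\<lambda>n::int. s [^]\<^bsub>curve_group E\<^esub>
          (n * (n + 1) div 2 * valuation F (shift E s (rep \<omega>) n) a)) UNIV) (orbits E s)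
    = \<one>\<^bsub>curve_group E\<^esub>" (is "_ \<longleftrightarrow> ?orbit_sums \<and> ?rest")
proof -
  interpret elliptic_translation E F s \<tau> rep
    by unfold_locales (fact assms)+
  let ?b = "\<lambda>P. valuation F P a"
  note conditions = shift_difference_conditions[of ?b]
  show ?thesis
    unfolding tau_quotient_iff[OF assms(7,8)]
  proof
    assume "\<exists>D. shift_difference ?b D \<and> principal D"
    then obtain D where D: "shift_difference ?b D" "principal D"
      by blast
    show "?orbit_sums \<and> ?rest"
      using conditions(1)[OF D(1)] iffD1[OF conditions(2)[OF D(1)] D(2)] by (rule conjI)
  next
    assume *: "?orbit_sums \<and> ?rest"
    \<comment> \<open>Only (1) is used to obtain D. Whether this D is principal is then decided by
      (2) and (3), whose left sides depend on \<open>a\<close> alone.\<close>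
    then obtain D where D: "shift_difference ?b D"
      using shift_difference_exists[OF finite_support_val[OF assms(7,8)]] by blast
    show "\<exists>D. shift_difference ?b D \<and> principal D"
      using D iffD2[OF conditions(2)[OF D] conjunct2[OF *]] by blast
  qed
qed

end
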